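(* Let $\Omega\subset\mathbb{R}^d$ be a bounded Lipschitz domain and let $\mathcal{T}$ be a partition of $\Omega$. For $\delta>0$ and $K\in\mathcal T$ define $K_\delta:=\bigcup_{\mathbf x\in K}B_\delta(\mathbf x)$. (i) Let $\widetilde\varepsilon\in L^\infty(\Omega)$ be piecewise constant on $\mathcal{T}$, i.e. $\widetilde\varepsilon|_K\in\mathbb{R}$ for each $K\in\mathcal{T}$. Assume that for some $C_\varepsilon,C_{\rm reg}>0$ and $M\in\mathbb{N}$: for every $K\in\mathcal{T}$, $$\operatorname{card}\{K'\in\mathcal{T}: K_{C_{\rm reg}\widetilde\varepsilon|_K}\cap K'_{C_{\rm reg}\widetilde\varepsilon|_{K'}}\neq\emptyset\}\le M,$$ and for all $K,K'\in\mathcal{T}$, $$K_{C_{\rm reg}\widetilde\varepsilon|_K}\cap K'_{C_{\rm reg}\widetilde\varepsilon|_{K'}}\neq\emptyset\ \Longrightarrow\ 0<\widetilde\varepsilon|_K\le C_\varepsilon\,\widetilde\varepsilon|_{K'}.$$ Then there exists a $\Lambda$-admissible length scale function $\varepsilon\in C^\infty(\Omega)$ such that $\varepsilon|_K\sim\widetilde\varepsilon|_K$ for all $K\in\mathcal{T}$. The implied constants as well as the sequence $\Lambda=(\mathcal{L},(\Lambda_{\mathbf r})_{\mathbf r\in\mathbb{N}_0^d})$ can be controlled in terms of $\Omega$, $C_\varepsilon$, $C_{\rm reg}$, $\|\widetilde\varepsilon\|_{L^\infty(\Omega)}$ and $M$ only. (ii) Let $\mathcal{T}$ be a $\gamma$-shape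 regular mesh on $\Omega$ and let $\mathbf p=(p_K)_{K\in\mathcal T}$ be a $\gamma_p$-shape regular polynomial degree distribution. Then there exists a $\Lambda$-admissible length scale function $\varepsilon\in C^\infty(\overline\Omega)$ with $\varepsilon>0$ on $\overline\Omega$ such that for every $K\in\mathcal{T}$ $$\varepsilon|_K\sim\frac{h_K}{p_K+1}\qquad\text{and}\qquad \Omega\cap\bigcup_{\mathbf x\in K}B_{\varepsilon(\mathbf x)}(\mathbf x)\subset\omega_K.$$ The implied constants as well as the sequence $\Lambda$ depend solely on $\gamma$, $\gamma_p$ and $\Omega$.
   Context: $B_r(\mathbf x)$ is the open ball of radius $r$ around $\mathbf x$. $\varepsilon|_K\sim a$ (with $a>0$) means $C^{-1}a\le\varepsilon(\mathbf x)\le Ca$ for all $\mathbf x\in K$ with a constant $C>0$ (the implied constant). A function $\varepsilon:\Omega\to\mathbb{R}$ is a $\Lambda$-admissible length scale function, where $\Lambda=(\mathcal{L},(\Lambda_{\mathbf r})_{\mathbf r\in\mathbb{N}_0^d})$ consists of non-negative numbers, if: $\varepsilon\in C^\infty(\Omega)$; $0<\varepsilon\le\Lambda_{\mathbf 0}$; $|D^{\mathbf r}\varepsilon|\le\Lambda_{\mathbf r}|\varepsilon|^{1-|\mathbf r|}$ pointwise in $\Omega$ for all $\mathbf r\in\mathbb{N}_0^d$; $\varepsilon$ is Lipschitz continuous with constant $\mathcal{L}$. A partition $\mathcal{T}$ of $\Omega$ is a collection of open, bounded, pairwise disjoint sets with $\overline\Omega=\bigcup_{K\in\mathcal{T}}\overline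 K$. $\omega_K$ is the interior of $\bigcup\{\overline{K'}:K'\in\mathcal T,\ \overline{K'}\cap\overline K\neq\emptyset\}$. A mesh is a finite partition in which every $K$ is the image of the reference simplex $\widehat K\subset\mathbb{R}^d$ under an affine map $F_K$; meshes are assumed regular in the sense of Ciarlet (no hanging nodes). $h_K=\operatorname{diam}K$. A mesh is $\gamma$-shape regular if $h_K^{-1}\|F_K'\|+h_K\|(F_K')^{-1}\|\le\gamma$ for all $K$. A polynomial degree distribution is a family $\mathbf p=(p_K)_{K\in\mathcal{T}}$, $p_K\in\mathbb{N}_0$; it is $\gamma_p$-shape regular if $\gamma_p^{-1}(p_K+1)\le p_{K'}+1\le\gamma_p(p_K+1)$ whenever $\overline K\cap\overline{K'}\neq\emptyset$.
   Formalization: In (ii), for d = 1 only, it is additionally assumed that h_K ≤ γ h_{K'} whenever the closures of K and K' intersect; without this the claim fails, since γ-shape regularity does not compare the lengths of neighbouring intervals. *)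

theory Defs
  imports "HOL-Analysis.Analysis" "HOL-Probability.Essential_Supremum"
begin

text \<open>Lipschitz domains: near every boundary point, \<open>\<Omega>\<close> is the strict epigraph of a Lipschitz
  function in a rotated coordinate system. The unit vector \<open>\<nu>\<close> is the last axis of that system,
  and \<open>y - (y \<bullet> \<nu>) *\<^sub>R \<nu>\<close> encodes the remaining \<open>d - 1\<close> coordinates of \<open>y\<close>.\<close>

definition bounded_lipschitz_domain :: "(real^'n) set \<Rightarrow> bool" where
  "bounded_lipschitz_domain \<Omega> \<longleftrightarrow>
     \<Omega> \<noteq> {} \<and> open \<Omega> \<and> connected \<Omega> \<and> bounded \<Omega> \<and>
     (\<forall>z\<in>frontier \<Omega>. \<exists>\<nu> r L g. norm \<nu> = 1 \<and> 0 < r \<and>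
        L-lipschitz_on {y. y \<bullet> \<nu> = 0} g \<and>
        \<Omega> \<inter> ball z r = {y \<in> ball z r. g (y - (y \<bullet> \<nu>) *\<^sub>R \<nu>) < y \<bullet> \<nu>})"

definition partial_deriv :: "'n \<Rightarrow> (real^'n \<Rightarrow> real) \<Rightarrow> real^'n \<Rightarrow> real" where
  "partial_deriv i f x = frechet_derivative f (at x) (axis i 1)"

definition partial_derivs :: "'n list \<Rightarrow> (real^'n \<Rightarrow> real) \<Rightarrow> real^'n \<Rightarrow> real" where
  "partial_derivs js f = foldr partial_deriv js f"

text \<open>For open \<open>S\<close>: differentiability of every iterated partial derivative on \<open>S\<close> also gives
  its continuity, so this is \<open>C\<^sup>\<infinity>(S)\<close>.\<close>

definition C_inf_on :: "(real^'n) set \<Rightarrow> (real^'n \<Rightarrow> real) \<Rightarrow> bool" where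
  "C_inf_on S f \<longleftrightarrow> (\<forall>js. \<forall>x\<in>S. partial_derivs js f differentiable (at x))"

text \<open>\<open>C\<^sup>\<infinity>\<close> on the closure of \<open>\<Omega>\<close>: restrictions of functions in \<open>C\<^sup>\<infinity>\<close> of the whole space.\<close>

definition C_inf_closure :: "(real^'n) set \<Rightarrow> (real^'n \<Rightarrow> real) \<Rightarrow> bool" where
  "C_inf_closure \<Omega> f \<longleftrightarrow> (\<exists>g. C_inf_on UNIV g \<and> (\<forall>x\<in>closure \<Omega>. f x = g x))"

definition mindex_order :: "('n::finite \<Rightarrow> nat) \<Rightarrow> nat" where
  "mindex_order r = (\<Sum>i\<in>UNIV. r i)"

text \<open>\<open>D\<^sup>r\<close> for a multi-index \<open>r\<close> differentiates \<open>r i\<close> times in direction \<open>i\<close>; the order of the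
  differentiations is left unspecified, as it is irrelevant for smooth functions.\<close>

definition multi_deriv :: "('n \<Rightarrow> nat) \<Rightarrow> (real^'n \<Rightarrow> real) \<Rightarrow> real^'n \<Rightarrow> real" where
  "multi_deriv r f = partial_derivs (SOME js. \<forall>i. count_list js i = r i) f"

definition admissible_length_scale ::
    "(real^'n) set \<Rightarrow> real \<times> (('n \<Rightarrow> nat) \<Rightarrow> real) \<Rightarrow> (real^'n \<Rightarrow> real) \<Rightarrow> bool" where
  "admissible_length_scale \<Omega> = (\<lambda>(L, \<Lambda>) \<epsilon>.
     0 \<le> L \<and> (\<forall>r. 0 \<le> \<Lambda> r) \<and>
     C_inf_on \<Omega> \<epsilon> \<and>
     (\<forall>x\<in>\<Omega>. 0 < \<epsilon> x \<and> \<epsilon> x \<le> \<Lambda> (\<lambda>_. 0)) \<and>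
     (\<forall>r. \<forall>x\<in>\<Omega>. \<bar>multi_deriv r \<epsilon> x\<bar> \<le> \<Lambda> r * \<bar>\<epsilon> x\<bar> powi (1 - int (mindex_order r))) \<and>
     L-lipschitz_on \<Omega> \<epsilon>)"

definition comparable_on :: "real \<Rightarrow> 'a set \<Rightarrow> ('a \<Rightarrow> real) \<Rightarrow> real \<Rightarrow> bool" where
  "comparable_on C K f a \<longleftrightarrow> (\<forall>x\<in>K. inverse C * a \<le> f x \<and> f x \<le> C * a)"

definition is_partition :: "(real^'n) set \<Rightarrow> (real^'n) set set \<Rightarrow> bool" where
  "is_partition \<Omega> \<T> \<longleftrightarrow>
     (\<forall>K\<in>\<T>. open K \<and> bounded K) \<and> pairwise disjnt \<T> \<and> closure \<Omega> = (\<Union>K\<in>\<T>. closure K)"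

definition nbhd :: "(real^'n) set \<Rightarrow> real \<Rightarrow> (real^'n) set" where
  "nbhd K \<delta> = (\<Union>x\<in>K. ball x \<delta>)"

definition Linf_norm :: "(real^'n) set \<Rightarrow> (real^'n \<Rightarrow> real) \<Rightarrow> ereal" where
  "Linf_norm \<Omega> f = esssup (lebesgue_on \<Omega>) (\<lambda>x. ereal \<bar>f x\<bar>)"

definition in_Linf :: "(real^'n) set \<Rightarrow> (real^'n \<Rightarrow> real) \<Rightarrow> bool" where
  "in_Linf \<Omega> f \<longleftrightarrow> f \<in> borel_measurable (lebesgue_on \<Omega>) \<and> Linf_norm \<Omega> f < \<infinity>"

text \<open>Elements are open, hence so is the reference simplex.\<close>

definition ref_simplex :: "(real^'n) set" where
  "ref_simplex = interior (convex hull (insert 0 Basis))"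

text \<open>The element map of \<open>K\<close> is \<open>F\<^sub>K x = A K *v x + b K\<close>, so \<open>A K\<close> is its Jacobian; openness of
  \<open>K\<close> forces \<open>A K\<close> to be invertible. The last clause is regularity in the sense of Ciarlet:
  two closed elements meet in a (possibly empty) common face.\<close>

definition is_mesh ::
    "(real^'n) set \<Rightarrow> (real^'n) set set \<Rightarrow> ((real^'n) set \<Rightarrow> real^'n^'n) \<Rightarrow>
     ((real^'n) set \<Rightarrow> real^'n) \<Rightarrow> bool" where
  "is_mesh \<Omega> \<T> A b \<longleftrightarrow>
     is_partition \<Omega> \<T> \<and> finite \<T> \<and>
     (\<forall>K\<in>\<T>. K = (\<lambda>x. A K *v x + b K) ` ref_simplex) \<and>
     (\<forall>K\<in>\<T>. \<forall>K'\<in>\<T>. (closure K \<inter> closure K') face_of closure K \<and>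
                     (closure K \<inter> closure K') face_of closure K')"

definition shape_regular_mesh ::
    "real \<Rightarrow> (real^'n) set set \<Rightarrow> ((real^'n) set \<Rightarrow> real^'n^'n) \<Rightarrow> bool" where
  "shape_regular_mesh \<gamma> \<T> A \<longleftrightarrow>
     (\<forall>K\<in>\<T>. inverse (diameter K) * onorm ((*v) (A K)) +
             diameter K * onorm ((*v) (matrix_inv (A K))) \<le> \<gamma>)"

text \<open>In dimension one the quantity bounded in \<open>shape_regular_mesh\<close> always equals 2, so it does not
  relate the sizes of neighbouring intervals, as it does for conforming meshes in dimension at
  least two; there this comparability has to be required separately.\<close>

definition comparable_neighbours :: "real \<Rightarrow> (real^'n) set set \<Rightarrow> bool" where
  "comparable_neighbours \<gamma> \<T> \<longleftrightarrow>
     (\<forall>K\<in>\<T>. \<forall>K'\<in>\<T>. closure K \<inter> closure K' \<noteq> {} \<longrightarrow> diameter K \<le> \<gamma> * diameter K')"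

definition shape_regular_degrees ::
    "real \<Rightarrow> (real^'n) set set \<Rightarrow> ((real^'n) set \<Rightarrow> nat) \<Rightarrow> bool" where
  "shape_regular_degrees \<gamma>p \<T> p \<longleftrightarrow>
     (\<forall>K\<in>\<T>. \<forall>K'\<in>\<T>. closure K \<inter> closure K' \<noteq> {} \<longrightarrow>
        inverse \<gamma>p * (real (p K) + 1) \<le> real (p K') + 1 \<and>
        real (p K') + 1 \<le> \<gamma>p * (real (p K) + 1))"

definition element_patch :: "(real^'n) set set \<Rightarrow> (real^'n) set \<Rightarrow> (real^'n) set" where
  "element_patch \<T> K = interior (\<Union>{closure K' |K'. K' \<in> \<T> \<and> closure K' \<inter> closure K \<noteq> {}})"

end

theory Submission
  imports Defs
begin

text \<open>
  Both parts come from one smoothing argument. Around every element \<open>K\<close> place a function that is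
  bounded below on \<open>closure K\<close>, vanishes outside the neighbourhood of radius \<open>Creg * e K\<close>, and whose
  derivatives of order \<open>m\<close> are of size \<open>(e K) ^ - m\<close>; then add up these functions with weights \<open>e K\<close>.
  Near a point of \<open>closure K\<close> only boundedly many summands are active and their weights are comparable
  to \<open>e K\<close>, so the sum is comparable to \<open>e K\<close> there and its derivatives of order \<open>m\<close> are of size
  \<open>(e K) ^ (1 - m)\<close>. Instead of a mollified indicator function, each element carries a finite sum of
  translates of one rescaled bump function, centred at a maximal separated set of points of the
  element. All iterated partial derivatives of such sums are explicit, and the number of bumps active at
  a point is bounded by a packing argument. The global Lipschitz bound follows from the gradient bound
  on balls of radius \<open>Creg * e K\<close>, which are convex and on which the active family is fixed; points
  further apart than that are handled by the bound \<open>\<epsilon> \<le> C * e K\<close> alone. This is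
  \<open>exists_length_scale\<close>. Part (i) follows, because the
  \<open>L\<^sup>\<infinity>\<close> norm bounds the value on every nonempty element.

  For part (ii) it is applied to a small multiple of \<open>diameter K / (p K + 1)\<close>. What has to be shown
  is that neighbourhoods of this size meet only for touching elements, that touching elements have
  comparable diameters, and that every element touches boundedly many others. This is where the Lipschitz
  boundary enters: points of \<open>\<Omega>\<close> at distance less than some \<open>\<delta>\<close> are joined inside \<open>\<Omega>\<close> by three
  segments of comparable length (\<open>bounded_lipschitz_domain_locally_quasiconvex\<close>).

  \<^item> Around a point \<open>v\<close>, the elements whose closure contains \<open>v\<close> contain disjoint balls of radius
    proportional to \<open>t\<close> inside the ball of radius \<open>t\<close>, for small \<open>t\<close>, so their number is bounded
    (\<open>card_elements_at_point\<close>).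
  \<^item> Two elements at \<open>v\<close> are linked by a chain of elements at \<open>v\<close> in which consecutive members share a
    second point, because \<open>\<Omega>\<close> without \<open>v\<close> is locally connected at \<open>v\<close> in dimension at least two; a
    second common point forces a common edge and hence comparable diameters
    (\<open>diameter_comparable_at_point\<close>).
  \<^item> The piecewise affine function that is \<open>1\<close> at the vertices in \<open>closure K\<close> and \<open>0\<close> at all other
    vertices has slope at most a constant over \<open>diameter K\<close>. It drops from \<open>1\<close> on \<open>K\<close> to \<open>0\<close> on every
    element not touching \<open>K\<close>, so along a short path in \<open>\<Omega>\<close> one cannot leave the patch of \<open>K\<close>
    before travelling a distance proportional to \<open>diameter K\<close> (\<open>close_points_in_patch\<close>).
\<close>

section \<open>A smooth cutoff function of one variable\<close>

text \<open>As \<open>p\<close> ranges over all polynomials these functions form a class closed under differentiation;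
  \<open>p = 1\<close> gives \<open>exp (- 1 / t)\<close>, extended by zero.\<close>

definition flat :: "real poly \<Rightarrow> real \<Rightarrow> real" where
  "flat p t = (if 0 < t then poly p (1 / t) * exp (- (1 / t)) else 0)"

lemma poly_times_exp_minus_tendsto_0: "((\<lambda>t::real. poly p t * exp (- t)) \<longlongrightarrow> 0) at_top"
proof -
  have "((\<lambda>t. \<Sum>i\<le>degree p. coeff p i * (t ^ i / exp t)) \<longlongrightarrow> (\<Sum>i\<le>degree p. coeff p i * 0)) at_top"
    by (intro tendsto_sum tendsto_mult tendsto_const tendsto_power_div_exp_0)
  moreover have "(\<lambda>t. \<Sum>i\<le>degree p. coeff p i * (t ^ i / exp t)) = (\<lambda>t. poly p t * exp (- t))"
    by (simp add: poly_altdef sum_distrib_right exp_minus divide_inverse mult.assoc)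
  ultimately show ?thesis by simp
qed

lemma flat_tendsto_0_right: "((\<lambda>t. flat p t) \<longlongrightarrow> 0) (at_right 0)"
proof -
  have "((\<lambda>t. poly p (inverse t) * exp (- inverse t)) \<longlongrightarrow> 0) (at_right 0)"
    by (rule filterlim_compose[OF poly_times_exp_minus_tendsto_0 filterlim_inverse_at_top_right])
  moreover have "\<forall>\<^sub>F t in at_right (0::real). poly p (inverse t) * exp (- inverse t) = flat p t"
    by (auto simp: flat_def eventually_at_right_field divide_inverse intro: exI[of _ 1])
  ultimately show ?thesis by (rule Lim_transform_eventually)
qed

text \<open>The only delicate point is \<open>t = 0\<close>: the difference quotient there is the function of the same
  class that belongs to \<open>pCons 0 p\<close>, and exponential decay beats the polynomial.\<close>

lemma DERIV_flat: "(flat p has_real_derivative flat ([:0, 0, 1:] * (p - pderiv p)) t) (at t)"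
proof (cases t "0::real" rule: linorder_cases)
  case less
  have "((\<lambda>_. 0) has_real_derivative 0) (at t)" by simp
  then have "(flat p has_real_derivative 0) (at t)"
    by (rule has_field_derivative_transform_within_open[where S="{..<0}"])
       (use less in \<open>auto simp: flat_def\<close>)
  with less show ?thesis by (simp add: flat_def)
next
  case equal
  have "(\<lambda>h. (flat p (0 + h) - flat p 0) / h) = flat (pCons 0 p)"
    by (auto simp: flat_def divide_inverse algebra_simps)
  moreover have "(flat (pCons 0 p) \<longlongrightarrow> 0) (at_left 0)"
    by (rule Lim_transform_eventually[where f="\<lambda>_. 0"])
       (auto simp: flat_def eventually_at_left_field intro: exI[of _ "-1"])
  ultimately have "(flat p has_real_derivative 0) (at 0)"
    unfolding DERIV_def by (simp add: filterlim_split_at flat_tendsto_0_right)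
  with equal show ?thesis by (simp add: flat_def)
next
  case greater
  have "((\<lambda>t. poly p (1 / t) * exp (- (1 / t))) has_real_derivative
         poly p (1 / t) * (exp (- (1 / t)) * (1 / t\<^sup>2)) + poly (pderiv p) (1 / t) * (- (1 / t\<^sup>2)) * exp (- (1 / t))) (at t)"
    using greater
    by (auto intro!: derivative_eq_intros DERIV_chain2[OF poly_DERIV] simp: power2_eq_square field_simps)
  also have "poly p (1 / t) * (exp (- (1 / t)) * (1 / t\<^sup>2)) + poly (pderiv p) (1 / t) * (- (1 / t\<^sup>2)) * exp (- (1 / t))
     = flat ([:0, 0, 1:] * (p - pderiv p)) t"
    using greater by (simp add: flat_def power2_eq_square field_simps)
  finally show ?thesis
    by (rule has_field_derivative_transform_within_open[where S="{0<..}"])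
       (use greater in \<open>auto simp: flat_def\<close>)
qed

text \<open>The successive derivatives are existential witnesses, so that closure properties follow from the
  differentiation rules without speaking about \<^const>\<open>deriv\<close>.\<close>

primrec times_differentiable :: "nat \<Rightarrow> (real \<Rightarrow> real) \<Rightarrow> bool" where
  "times_differentiable 0 f = True"
| "times_differentiable (Suc n) f =
     (\<exists>f'. (\<forall>t. (f has_real_derivative f' t) (at t)) \<and> times_differentiable n f')"

lemma times_differentiable_diff:
  "times_differentiable n f \<Longrightarrow> times_differentiable n g \<Longrightarrow> times_differentiable n (\<lambda>t. f t - g t)"
proof (induction n arbitrary: f g)
  case (Suc n)
  then obtain f' g' where "\<forall>t. (f has_real_derivative f' t) (at t)" "times_differentiable n f'"
    "\<forall>t. (g has_real_derivative g' t) (at t)" "times_differentiable n g'"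
    by auto
  with Suc.IH show ?case
    by (auto intro!: exI[of _ "\<lambda>t. f' t - g' t"] derivative_intros)
qed simp

definition cutoff :: "real \<Rightarrow> real" where
  "cutoff t = flat 1 (1 + t) * flat 1 (1 - t)"

text \<open>The derivative is a difference of two products of the same shape with other polynomials, so the
  induction runs over all pairs of polynomials simultaneously.\<close>

lemma times_differentiable_flat_mult:
  "times_differentiable n (\<lambda>t. flat p (1 + t) * flat q (1 - t))"
proof (induction n arbitrary: p q)
  case (Suc n)
  let ?D = "\<lambda>p::real poly. [:0, 0, 1:] * (p - pderiv p)"
  have "((\<lambda>t. flat p (1 + t) * flat q (1 - t)) has_real_derivative
          flat (?D p) (1 + t) * flat q (1 - t) - flat p (1 + t) * flat (?D q) (1 - t)) (at t)" for t
    by (rule derivative_eq_intros DERIV_chain2[OF DERIV_flat] | simp)+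
  with times_differentiable_diff[OF Suc.IH Suc.IH] show ?case
    by (auto intro!: exI)
qed simp

lemma times_differentiable_deriv:
  assumes "times_differentiable (Suc n) f"
  shows "(f has_real_derivative deriv f t) (at t)" "times_differentiable n (deriv f)"
proof -
  obtain f' where f': "\<forall>t. (f has_real_derivative f' t) (at t)" "times_differentiable n f'"
    using assms by auto
  then have "deriv f = f'" by (auto intro: DERIV_imp_deriv)
  with f' show "(f has_real_derivative deriv f t) (at t)" "times_differentiable n (deriv f)" by auto
qed

definition cutoff_deriv :: "nat \<Rightarrow> real \<Rightarrow> real" where
  "cutoff_deriv k = (deriv ^^ k) cutoff"

lemma DERIV_cutoff_deriv: "(cutoff_deriv k has_real_derivative cutoff_deriv (Suc k) t) (at t)"
proof -
  have "times_differentiable n ((deriv ^^ k) cutoff)" for n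
    by (induction k arbitrary: n)
       (auto intro: times_differentiable_deriv(2) simp: cutoff_def[abs_def] times_differentiable_flat_mult)
  from times_differentiable_deriv(1)[OF this] show ?thesis
    by (simp add: cutoff_deriv_def)
qed

lemma cutoff_deriv_eq_0: "1 < \<bar>t\<bar> \<Longrightarrow> cutoff_deriv k t = 0"
proof (induction k arbitrary: t)
  case 0
  then show ?case by (auto simp: cutoff_deriv_def cutoff_def flat_def)
next
  case (Suc k)
  have "open {t::real. 1 < \<bar>t\<bar>}"
    by (intro open_Collect_less continuous_intros)
  then have "(cutoff_deriv k has_real_derivative 0) (at t)"
    by (rule has_field_derivative_transform_within_open[where f="\<lambda>_. 0", rotated]) (use Suc in auto)
  with DERIV_cutoff_deriv show ?case by (rule DERIV_unique)
qed

text \<open>A continuous function on \<open>[-1, 1]\<close> is bounded, and outside this interval the derivatives vanish.\<close>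

lemma cutoff_deriv_bounded: "\<exists>B. \<forall>t. \<bar>cutoff_deriv k t\<bar> \<le> B"
proof -
  have "continuous_on {-1..1} (cutoff_deriv k)"
    by (meson DERIV_cutoff_deriv DERIV_isCont continuous_at_imp_continuous_on)
  then have "bounded (cutoff_deriv k ` {-1..1})"
    by (intro compact_imp_bounded compact_continuous_image) auto
  then obtain B where B: "\<bar>cutoff_deriv k t\<bar> \<le> B" if "t \<in> {-1..1}" for t
    unfolding bounded_iff by fastforce
  have "\<bar>cutoff_deriv k t\<bar> \<le> \<bar>B\<bar>" for t
    using B[of t] cutoff_deriv_eq_0[of t k] by (cases "t \<in> {-1..1}") fastforce+
  then show ?thesis by blast
qed

lemma cutoff_deriv_0: "cutoff_deriv 0 = cutoff"
  by (simp add: cutoff_deriv_def)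

lemma cutoff_nonneg: "0 \<le> cutoff t" and cutoff_eq_0: "1 \<le> \<bar>t\<bar> \<Longrightarrow> cutoff t = 0"
  by (auto simp: cutoff_def flat_def)

lemma cutoff_lower_bound:
  assumes "\<bar>t\<bar> \<le> 1 / 2"
  shows "exp (- 4) \<le> cutoff t"
proof -
  have "1 / (1 + t) \<le> 2" "1 / (1 - t) \<le> 2" using assms by (auto simp: field_simps abs_le_iff)
  then have "exp (- 4) \<le> exp (- (1 / (1 + t)) + - (1 / (1 - t)))" by (subst exp_le_cancel_iff) linarith
  also have "\<dots> = cutoff t" using assms by (auto simp: cutoff_def flat_def abs_le_iff simp flip: exp_add)
  finally show ?thesis .
qed

section \<open>Bump functions and their partial derivatives\<close>

text \<open>For \<open>k = 0\<close> this is a product bump of width \<open>s\<close> around \<open>z\<close>. For general \<open>k\<close> it is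
  the derivative of that bump with multi-index \<open>k\<close>, multiplied by \<open>s\<close> to the power of the order; with
  the power of \<open>s\<close> split off, its size is independent of \<open>s\<close>.\<close>

definition bump :: "('n \<Rightarrow> nat) \<Rightarrow> real^'n \<Rightarrow> real \<Rightarrow> real^'n \<Rightarrow> real" where
  "bump k z s x = (\<Prod>i\<in>UNIV. cutoff_deriv (k i) ((x $ i - z $ i) / s))"

lemma bump_has_derivative:
  fixes z :: "real^'n"
  shows "(bump k z s has_derivative (\<lambda>h. \<Sum>i\<in>UNIV. h $ i * (1 / s * bump (k(i := Suc (k i))) z s x))) (at x)"
proof -
  let ?u = "\<lambda>i x. (x $ i - z $ i) / s"
  have 1: "((\<lambda>x. cutoff_deriv (k i) (?u i x)) has_derivative
          (\<lambda>h. cutoff_deriv (Suc (k i)) (?u i x) * (h $ i / s))) (at x)" for i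
  proof -
    have "(?u i has_derivative (\<lambda>h. h $ i / s)) (at x)"
      by (auto intro!: derivative_eq_intros bounded_linear_imp_has_derivative simp: divide_inverse)
    from DERIV_compose_FDERIV[OF DERIV_cutoff_deriv this] show ?thesis by (simp only: mult.commute)
  qed
  have "(bump k z s has_derivative
      (\<lambda>h. \<Sum>i\<in>UNIV. cutoff_deriv (Suc (k i)) (?u i x) * (h $ i / s) *
             (\<Prod>j\<in>UNIV - {i}. cutoff_deriv (k j) (?u j x)))) (at x)"
    unfolding bump_def[abs_def] using 1 by (rule has_derivative_prod)
  moreover have "cutoff_deriv (Suc (k i)) (?u i x) * (h $ i / s) *
             (\<Prod>j\<in>UNIV - {i}. cutoff_deriv (k j) (?u j x))
     = h $ i * (1 / s * bump (k(i := Suc (k i))) z s x)" for i and h :: "real^'n"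
    unfolding bump_def by (subst prod.remove[of UNIV i]) (simp_all cong: prod.cong_simp)
  ultimately show ?thesis by (simp only:)
qed

lemma bump_sum_has_derivative:
  fixes z :: "'a \<Rightarrow> real^'n"
  shows "((\<lambda>x. \<Sum>a\<in>A. c a * bump (k a) (z a) (s a) x) has_derivative
    (\<lambda>h. \<Sum>i\<in>UNIV. h $ i * (\<Sum>a\<in>A. c a / s a * bump ((k a)(i := Suc (k a i))) (z a) (s a) x))) (at x)"
proof -
  have "((\<lambda>x. \<Sum>a\<in>A. c a * bump (k a) (z a) (s a) x) has_derivative
     (\<lambda>h. \<Sum>a\<in>A. c a * (\<Sum>i\<in>UNIV. h $ i * (1 / s a * bump ((k a)(i := Suc (k a i))) (z a) (s a) x)))) (at x)"
    by (intro has_derivative_sum has_derivative_mult_right bump_has_derivative)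
  also have "(\<lambda>h::real^'n. \<Sum>a\<in>A. c a * (\<Sum>i\<in>UNIV. h $ i * (1 / s a * bump ((k a)(i := Suc (k a i))) (z a) (s a) x)))
    = (\<lambda>h. \<Sum>i\<in>UNIV. h $ i * (\<Sum>a\<in>A. c a / s a * bump ((k a)(i := Suc (k a i))) (z a) (s a) x))"
  proof
    fix h :: "real^'n"
    let ?g = "\<lambda>a i. h $ i * (c a / s a * bump ((k a)(i := Suc (k a i))) (z a) (s a) x)"
    have "(\<Sum>a\<in>A. c a * (\<Sum>i\<in>UNIV. h $ i * (1 / s a * bump ((k a)(i := Suc (k a i))) (z a) (s a) x)))
        = (\<Sum>a\<in>A. \<Sum>i\<in>UNIV. ?g a i)"
      by (intro sum.cong refl) (simp add: sum_distrib_left mult_ac)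
    also have "\<dots> = (\<Sum>i\<in>UNIV. \<Sum>a\<in>A. ?g a i)" by (rule sum.swap)
    finally show "(\<Sum>a\<in>A. c a * (\<Sum>i\<in>UNIV. h $ i * (1 / s a * bump ((k a)(i := Suc (k a i))) (z a) (s a) x)))
      = (\<Sum>i\<in>UNIV. h $ i * (\<Sum>a\<in>A. c a / s a * bump ((k a)(i := Suc (k a i))) (z a) (s a) x))"
      by (simp only: sum_distrib_left)
  qed
  finally show ?thesis .
qed

lemma partial_deriv_bump_sum:
  fixes z :: "'a \<Rightarrow> real^'n"
  shows "partial_deriv j (\<lambda>x. \<Sum>a\<in>A. c a * bump (k a) (z a) (s a) x) =
   (\<lambda>x. \<Sum>a\<in>A. c a / s a * bump ((k a)(j := Suc (k a j))) (z a) (s a) x)"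
proof
  fix x
  have "(\<Sum>i\<in>UNIV. axis j 1 $ i * g i) = g j" for g :: "'n \<Rightarrow> real"
    by (simp add: axis_def if_distribR if_distrib[of "\<lambda>t. t * _"] cong: if_cong)
  then show "partial_deriv j (\<lambda>x. \<Sum>a\<in>A. c a * bump (k a) (z a) (s a) x) x =
    (\<Sum>a\<in>A. c a / s a * bump ((k a)(j := Suc (k a j))) (z a) (s a) x)"
    unfolding partial_deriv_def frechet_derivative_at[OF bump_sum_has_derivative, symmetric]
    by simp
qed

text \<open>Differentiating in direction \<open>j\<close> raises \<open>k j\<close> by one and costs a factor \<open>1 / s\<close>. In particular
  only the number of occurrences of each direction in \<open>js\<close> matters, which settles the arbitrary order of
  differentiation in \<^const>\<open>multi_deriv\<close>.\<close>

lemma partial_derivs_bump_sum: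
  fixes z :: "'a \<Rightarrow> real^'n"
  shows "partial_derivs js (\<lambda>x. \<Sum>a\<in>A. c a * bump (\<lambda>_. 0) (z a) (s a) x) =
   (\<lambda>x. \<Sum>a\<in>A. c a / s a ^ length js * bump (count_list js) (z a) (s a) x)"
proof (induction js)
  case Nil
  have "count_list [] = (\<lambda>_::'n. 0)" by auto
  then show ?case by (simp add: partial_derivs_def)
next
  case (Cons j js)
  have *: "(count_list js)(j := Suc (count_list js j)) = count_list (j # js)" by auto
  have "partial_derivs (j # js) (\<lambda>x. \<Sum>a\<in>A. c a * bump (\<lambda>_. 0) (z a) (s a) x) =
     partial_deriv j (\<lambda>x. \<Sum>a\<in>A. c a / s a ^ length js * bump (count_list js) (z a) (s a) x)"
    using Cons by (simp add: partial_derivs_def)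
  also have "\<dots> = (\<lambda>x. \<Sum>a\<in>A. c a / s a ^ length js / s a * bump (count_list (j # js)) (z a) (s a) x)"
    unfolding partial_deriv_bump_sum * ..
  finally show ?case by (simp add: power_Suc2 del: power_Suc count_list.simps)
qed

text \<open>The Frechet derivative at a point is chosen among all derivatives there, and which linear maps are
  derivatives depends on the function near the point only.\<close>

lemma partial_derivs_cong_open:
  assumes "open U" "\<And>x. x \<in> U \<Longrightarrow> f x = g x" "x \<in> U"
  shows "partial_derivs js f x = partial_derivs js g x"
  using assms(3)
proof (induction js arbitrary: x)
  case Nil
  then show ?case by (simp add: partial_derivs_def assms)
next
  case (Cons j js)
  have "(partial_derivs js f has_derivative f') (at x) \<longleftrightarrow> (partial_derivs js g has_derivative f') (at x)" for f'
    using has_derivative_transform_within_open[OF _ assms(1) Cons.prems] Cons.IH by metis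
  then show ?case by (simp add: partial_derivs_def partial_deriv_def frechet_derivative_def)
qed

lemma bump_bounded:
  fixes k :: "'n::finite \<Rightarrow> nat"
  shows "\<exists>B\<ge>0. \<forall>z s x. \<bar>bump k z s x\<bar> \<le> B"
proof -
  obtain B where B: "\<And>m t. \<bar>cutoff_deriv m t\<bar> \<le> B m" using cutoff_deriv_bounded by metis
  then have "0 \<le> B m" for m by (meson abs_ge_zero order_trans)
  with B show ?thesis
    by (intro exI[of _ "\<Prod>i\<in>UNIV. B (k i)"]) (auto simp: bump_def abs_prod intro!: prod_mono prod_nonneg)
qed

lemma bump_nonneg: "0 \<le> bump (\<lambda>_. 0) z s x"
  by (auto simp: bump_def cutoff_deriv_0 cutoff_nonneg intro: prod_nonneg)

lemma bump_eq_0_far: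
  fixes z x :: "real^'n"
  assumes s: "0 < s" and x: "real CARD('n) * s < dist z x"
  shows "bump k z s x = 0"
proof (rule ccontr)
  assume "bump k z s x \<noteq> 0"
  then have "\<bar>(x $ i - z $ i) / s\<bar> \<le> 1" for i
    unfolding bump_def using cutoff_deriv_eq_0 by (metis finite iso_tuple_UNIV_I not_le prod_zero_iff)
  then have "\<bar>(z - x) $ i\<bar> \<le> s" for i
    using s by (auto simp: abs_divide divide_le_eq_1 abs_minus_commute)
  then have "norm (z - x) \<le> (\<Sum>i\<in>(UNIV::'n set). s)"
    by (intro order_trans[OF norm_le_l1_cart] sum_mono)
  with x show False by (simp add: dist_norm)
qed

text \<open>For the bump itself, as opposed to its derivatives, the boundary case of equality is included;
  this makes it vanish off the open neighbourhoods used below.\<close>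

lemma bump_eq_0:
  fixes z x :: "real^'n"
  assumes s: "0 < s" and x: "real CARD('n) * s \<le> dist z x"
  shows "bump (\<lambda>_. 0) z s x = 0"
proof (rule ccontr)
  assume "bump (\<lambda>_. 0) z s x \<noteq> 0"
  then have "\<bar>(x $ i - z $ i) / s\<bar> < 1" for i
    unfolding bump_def cutoff_deriv_0 using cutoff_eq_0 by (metis finite iso_tuple_UNIV_I not_le prod_zero_iff)
  then have "\<bar>(z - x) $ i\<bar> < s" for i
    using s by (auto simp: abs_divide divide_less_eq_1 abs_minus_commute)
  then have "norm (z - x) < (\<Sum>i\<in>(UNIV::'n set). s)"
    by (intro order.strict_trans1[OF norm_le_l1_cart] sum_strict_mono) auto
  with x show False by (simp add: dist_norm)
qed

lemma bump_lower_bound: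
  fixes z x :: "real^'n"
  assumes s: "0 < s" and x: "dist z x \<le> s / 2"
  shows "exp (- 4) ^ CARD('n) \<le> bump (\<lambda>_. 0) z s x"
proof -
  have "\<bar>(x $ i - z $ i) / s\<bar> \<le> 1 / 2" for i
  proof -
    have "\<bar>x $ i - z $ i\<bar> \<le> s / 2"
      using component_le_norm_cart[of "x - z" i] x by (simp add: dist_norm norm_minus_commute)
    then show ?thesis using s by (simp add: field_simps)
  qed
  then have "(\<Prod>i\<in>(UNIV::'n set). exp (- 4)) \<le> bump (\<lambda>_. 0) z s x"
    unfolding bump_def cutoff_deriv_0 by (intro prod_mono) (auto simp: cutoff_lower_bound)
  then show ?thesis by simp
qed

section \<open>Separated sets of points\<close>

definition separated :: "real \<Rightarrow> 'a::metric_space set \<Rightarrow> bool" where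
  "separated s Z \<longleftrightarrow> (\<forall>p\<in>Z. \<forall>q\<in>Z. p \<noteq> q \<longrightarrow> s \<le> dist p q)"

text \<open>Rescaled to the unit ball, \<open>Z\<close> is \<open>\<eta>\<close>-separated. Finitely many balls of radius \<open>\<eta> / 2\<close> cover
  the unit ball, and each of them contains at most one point of the rescaled set.\<close>

lemma separated_card_bounded:
  assumes "0 < \<eta>"
  shows "\<exists>N. \<forall>t>0. \<forall>(v::'a::euclidean_space) Z. Z \<subseteq> cball v t \<and> separated (\<eta> * t) Z \<longrightarrow> finite Z \<and> card Z \<le> N"
proof -
  have "compact (cball (0::'a) 1)" by simp
  then obtain P where P: "finite P" "cball (0::'a) 1 \<subseteq> (\<Union>p\<in>P. ball p (\<eta> / 2))"
    using assms compact_eq_totally_bounded[of "cball (0::'a) 1"] by (meson half_gt_zero)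
  show ?thesis
  proof (intro exI[of _ "card P"] allI impI; elim conjE)
    fix t :: real and v :: 'a and Z
    assume t: "0 < t" and Z: "Z \<subseteq> cball v t" and sep: "separated (\<eta> * t) Z"
    have "\<exists>p\<in>P. dist p ((z - v) /\<^sub>R t) < \<eta> / 2" if "z \<in> Z" for z
    proof -
      have "(z - v) /\<^sub>R t \<in> cball 0 1"
      proof -
        have "norm (z - v) \<le> t" using Z that by (auto simp: dist_norm norm_minus_commute)
        with t show ?thesis by (simp add: dist_norm del: scaleR_left_diff_distrib scaleR_right_diff_distrib) (simp add: field_simps)
      qed
      with P show ?thesis by (auto simp: subset_iff)
    qed
    then obtain c where c: "\<And>z. z \<in> Z \<Longrightarrow> c z \<in> P \<and> dist (c z) ((z - v) /\<^sub>R t) < \<eta> / 2"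
      by metis
    have "inj_on c Z"
    proof (rule inj_onI, rule ccontr)
      fix p q assume pq: "p \<in> Z" "q \<in> Z" "c p = c q" "p \<noteq> q"
      have "dist ((p - v) /\<^sub>R t) ((q - v) /\<^sub>R t) < \<eta>"
        using c[OF pq(1)] c[OF pq(2)] pq(3) dist_triangle_half_r by metis
      moreover have "dist ((p - v) /\<^sub>R t) ((q - v) /\<^sub>R t) = dist p q / t"
        using t by (simp add: dist_norm divide_inverse mult.commute flip: scaleR_diff_right)
      ultimately have "dist p q < \<eta> * t" using t by (simp only: divide_less_eq if_True)
      with sep pq show False unfolding separated_def by (meson not_le)
    qed
    moreover have "c ` Z \<subseteq> P" using c by auto
    ultimately show "finite Z \<and> card Z \<le> card P"
      using P(1) by (meson card_inj_on_le inj_on_finite)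
  qed
qed

text \<open>Separated subsets of \<open>K\<close> have bounded cardinality, so there is a largest one; as it cannot be
  enlarged, the closed balls around its points cover \<open>K\<close>, and then also \<open>closure K\<close> because they are
  finitely many.\<close>

lemma maximal_separated_subset:
  fixes K :: "'a::euclidean_space set"
  assumes "bounded K" "0 < s"
  shows "\<exists>Z\<subseteq>K. finite Z \<and> separated s Z \<and> (\<forall>x\<in>closure K. \<exists>z\<in>Z. dist z x \<le> s)"
proof -
  obtain v t0 where "K \<subseteq> cball v t0" using assms(1) bounded_subset_cball by metis
  then have K: "K \<subseteq> cball v (max t0 1)" (is "_ \<subseteq> cball v ?t") by (auto simp: subset_iff le_max_iff_disj)
  define good where "good Z \<longleftrightarrow> Z \<subseteq> K \<and> separated s Z" for Z
  have s: "s / ?t * ?t = s" "0 < ?t" "0 < s / ?t" using assms(2) by (auto simp: less_max_iff_disj)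
  obtain N where "\<forall>t>0. \<forall>(v::'a) Z. Z \<subseteq> cball v t \<and> separated (s / ?t * t) Z \<longrightarrow> finite Z \<and> card Z \<le> N"
    using separated_card_bounded[OF s(3)] by blast
  from this[rule_format, OF s(2), of _ v] have N: "finite Z \<and> card Z \<le> N" if "good Z" for Z
    using that K unfolding good_def s(1) by blast
  have "good {}" by (simp add: good_def separated_def)
  then obtain Z where Z: "good Z" and max: "\<And>Z'. good Z' \<Longrightarrow> card Z' \<le> card Z"
    using ex_has_greatest_nat[of good "{}" card "Suc N"] N by (auto simp: less_Suc_eq_le)
  have "\<exists>z\<in>Z. dist z x \<le> s" if x: "x \<in> K" for x
  proof (rule ccontr)
    assume no: "\<not> ?thesis"
    then have "x \<notin> Z" using assms(2) by auto
    moreover have "good (insert x Z)"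
      using Z x no unfolding good_def separated_def by (auto simp: dist_commute) 
    ultimately show False using max[of "insert x Z"] N[OF Z] by simp
  qed
  then have "K \<subseteq> (\<Union>z\<in>Z. cball z s)" by auto
  then have "closure K \<subseteq> (\<Union>z\<in>Z. cball z s)"
    using N[OF Z] by (intro closure_minimal closed_UN) auto
  with Z N[OF Z] show ?thesis by (intro exI[of _ Z]) (auto simp: good_def subset_iff)
qed

section \<open>Smoothing of locally comparable sizes\<close>

lemma bump_sum_smooth:
  fixes z :: "'a \<Rightarrow> real^'n"
  assumes U: "open U" and f: "\<And>x. x \<in> U \<Longrightarrow> f x = (\<Sum>a\<in>A. c a * bump (\<lambda>_. 0) (z a) (s a) x)"
    and x: "x \<in> U"
  shows "partial_derivs js f x = (\<Sum>a\<in>A. c a / s a ^ length js * bump (count_list js) (z a) (s a) x)"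
    and "partial_derivs js f differentiable (at x)"
proof -
  have eq: "partial_derivs js f y = (\<Sum>a\<in>A. c a / s a ^ length js * bump (count_list js) (z a) (s a) y)"
    if "y \<in> U" for y
    using partial_derivs_cong_open[OF U f that] by (simp add: partial_derivs_bump_sum)
  then show "partial_derivs js f x = (\<Sum>a\<in>A. c a / s a ^ length js * bump (count_list js) (z a) (s a) x)"
    using x .
  show "partial_derivs js f differentiable (at x)"
    unfolding differentiable_def
    using has_derivative_transform_within_open[OF bump_sum_has_derivative U x eq[symmetric]] by blast
qed

lemma partial_derivs_bounded_imp_lipschitz:
  fixes f :: "real^'n \<Rightarrow> real"
  assumes S: "convex S" and f: "\<And>x. x \<in> S \<Longrightarrow> f differentiable (at x)"
    and G: "\<And>x i. x \<in> S \<Longrightarrow> \<bar>partial_deriv i f x\<bar> \<le> G" and xy: "x \<in> S" "y \<in> S"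
  shows "\<bar>f x - f y\<bar> \<le> real CARD('n) * G * norm (x - y)"
proof -
  have "onorm (frechet_derivative f (at w)) \<le> real CARD('n) * G" if w: "w \<in> S" for w
  proof (rule onorm_le)
    fix h
    let ?f' = "frechet_derivative f (at w)"
    have "linear ?f'"
      using f[OF w] by (rule linear_frechet_derivative)
    then have "?f' h = (\<Sum>i\<in>UNIV. h $ i * partial_deriv i f w)"
      by (subst basis_expansion[symmetric, of h])
         (simp add: linear_sum linear_scale scalar_mult_eq_scaleR partial_deriv_def)
    then have "norm (?f' h) \<le> (\<Sum>i\<in>UNIV. \<bar>h $ i * partial_deriv i f w\<bar>)" by (simp add: sum_abs)
    also have "\<dots> \<le> (\<Sum>i\<in>(UNIV::'n set). norm h * G)"
      using G[OF w] by (intro sum_mono) (auto simp: abs_mult intro!: mult_mono component_le_norm_cart)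
    finally show "norm (?f' h) \<le> real CARD('n) * G * norm h" by (simp add: mult_ac)
  qed
  then show ?thesis
    using differentiable_bound[OF S, of f "\<lambda>w. frechet_derivative f (at w)" "real CARD('n) * G" y x] xy f
    by (simp add: frechet_derivative_works has_derivative_at_withinI norm_minus_commute abs_minus_commute)
qed

lemma open_nbhd: "open (nbhd K \<delta>)"
  by (auto simp: nbhd_def)

lemma ball_subset_nbhd:
  assumes "x \<in> closure K"
  shows "ball x \<delta> \<subseteq> nbhd K \<delta>"
proof
  fix y assume y: "y \<in> ball x \<delta>"
  then obtain w where "w \<in> K" "dist w x < \<delta> - dist x y"
    using assms unfolding closure_approachable by (metis diff_gt_0_iff_gt mem_ball)
  then show "y \<in> nbhd K \<delta>"
    unfolding nbhd_def using dist_triangle[of w y x] by force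
qed

text \<open>The finite sets \<open>Z K\<close> are the centres of the bumps that represent \<open>K\<close>. With width
  \<open>Creg * e K / CARD('n)\<close> a bump is supported in the ball of radius \<open>Creg * e K\<close>, since the Euclidean
  norm is at most the sum of the moduli of the coordinates.\<close>

locale length_scale_data =
  fixes \<T> :: "(real^'n) set set" and e :: "(real^'n) set \<Rightarrow> real" and Creg C\<epsilon> :: real and M :: nat
    and Z :: "(real^'n) set \<Rightarrow> (real^'n) set"
  assumes Creg_pos: "0 < Creg" and C\<epsilon>_ge_1: "1 \<le> C\<epsilon>" and e_pos: "K \<in> \<T> \<Longrightarrow> 0 < e K"
    and Z: "K \<in> \<T> \<Longrightarrow> Z K \<subseteq> K" "K \<in> \<T> \<Longrightarrow> finite (Z K)"
      "K \<in> \<T> \<Longrightarrow> separated (Creg * e K / CARD('n) / 2) (Z K)"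
      "K \<in> \<T> \<Longrightarrow> x \<in> closure K \<Longrightarrow> \<exists>z\<in>Z K. dist z x \<le> Creg * e K / CARD('n) / 2"
    and overlap: "K \<in> \<T> \<Longrightarrow> finite {K'\<in>\<T>. nbhd K (Creg * e K) \<inter> nbhd K' (Creg * e K') \<noteq> {}}"
      "K \<in> \<T> \<Longrightarrow> card {K'\<in>\<T>. nbhd K (Creg * e K) \<inter> nbhd K' (Creg * e K') \<noteq> {}} \<le> M"
    and comparable: "K \<in> \<T> \<Longrightarrow> K' \<in> \<T> \<Longrightarrow> nbhd K (Creg * e K) \<inter> nbhd K' (Creg * e K') \<noteq> {}
      \<Longrightarrow> e K \<le> C\<epsilon> * e K'"
begin

definition reach :: "(real^'n) set \<Rightarrow> (real^'n) set" where
  "reach K = nbhd K (Creg * e K)"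

definition overlapping :: "(real^'n) set \<Rightarrow> (real^'n) set set" where
  "overlapping K = {K'\<in>\<T>. reach K \<inter> reach K' \<noteq> {}}"

definition width :: "(real^'n) set \<Rightarrow> real" where
  "width K = Creg * e K / CARD('n)"

text \<open>The inner sum plays the role of a mollified indicator function of \<open>K\<close>. Outside \<open>reach K\<close> it
  vanishes, so restricting the outer sum to the elements whose reach contains \<open>x\<close> does not change the
  value but keeps the sum finite when \<open>\<T>\<close> is infinite.\<close>

definition smoothed_size :: "real^'n \<Rightarrow> real" where
  "smoothed_size x = (\<Sum>K\<in>{K\<in>\<T>. x \<in> reach K}. e K * (\<Sum>z\<in>Z K. bump (\<lambda>_. 0) z (width K) x))"

lemma width_pos: "K \<in> \<T> \<Longrightarrow> 0 < width K"
  using Creg_pos e_pos by (auto simp: width_def)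

lemma CARD_width: "real CARD('n) * width K = Creg * e K"
  by (simp add: width_def)

lemma ball_subset_reach: "x \<in> closure K \<Longrightarrow> ball x (Creg * e K) \<subseteq> reach K"
  unfolding reach_def by (rule ball_subset_nbhd)

lemma in_reach: "K \<in> \<T> \<Longrightarrow> x \<in> closure K \<Longrightarrow> x \<in> reach K"
  using ball_subset_reach[of x K] e_pos[of K] Creg_pos by (auto simp: subset_iff)

lemma smoothed_size_eq_sum:
  assumes T': "finite T'" "T' \<subseteq> \<T>" "{K\<in>\<T>. x \<in> reach K} \<subseteq> T'"
  shows "smoothed_size x = (\<Sum>a\<in>Sigma T' Z. e (fst a) * bump (\<lambda>_. 0) (snd a) (width (fst a)) x)"
proof -
  have far: "bump (\<lambda>_. 0) z (width K) x = 0" if "K \<in> \<T>" "x \<notin> reach K" "z \<in> Z K" for K z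
  proof -
    have "z \<in> K" using that Z(1) by auto
    then have "real CARD('n) * width K \<le> dist z x"
      using that(2) by (auto simp: CARD_width reach_def nbhd_def not_less)
    then show ?thesis by (rule bump_eq_0[OF width_pos[OF that(1)]])
  qed
  then have "(\<Sum>z\<in>Z K. bump (\<lambda>_. 0) z (width K) x) = 0" if "K \<in> \<T>" "x \<notin> reach K" for K
    using that by (intro sum.neutral) auto
  then have "smoothed_size x = (\<Sum>K\<in>T'. e K * (\<Sum>z\<in>Z K. bump (\<lambda>_. 0) z (width K) x))"
    unfolding smoothed_size_def using T' by (intro sum.mono_neutral_left) auto
  also have "\<dots> = (\<Sum>K\<in>T'. \<Sum>z\<in>Z K. e K * bump (\<lambda>_. 0) z (width K) x)"
    by (simp add: sum_distrib_left)
  also have "\<dots> = (\<Sum>a\<in>Sigma T' Z. e (fst a) * bump (\<lambda>_. 0) (snd a) (width (fst a)) x)"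
    using T' Z(2) by (subst sum.Sigma) (auto simp: case_prod_beta)
  finally show ?thesis .
qed

lemma overlapping_subset: "overlapping K \<subseteq> \<T>"
  by (auto simp: overlapping_def)

lemma finite_overlapping: "K \<in> \<T> \<Longrightarrow> finite (overlapping K)"
  and card_overlapping: "K \<in> \<T> \<Longrightarrow> card (overlapping K) \<le> M"
  using overlap by (simp_all add: overlapping_def reach_def)

text \<open>The index set does not depend on \<open>x\<close> any more. Hence on the open set \<open>reach K\<close> the function is a
  fixed finite sum of bumps and can be differentiated termwise.\<close>

lemma smoothed_size_eq_sum_overlapping:
  assumes "K \<in> \<T>" "x \<in> reach K"
  shows "smoothed_size x = (\<Sum>a\<in>Sigma (overlapping K) Z. e (fst a) * bump (\<lambda>_. 0) (snd a) (width (fst a)) x)"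
  using assms by (intro smoothed_size_eq_sum finite_overlapping overlapping_subset) (auto simp: overlapping_def)

lemma partial_derivs_smoothed_size:
  assumes "K \<in> \<T>" "x \<in> reach K"
  shows "partial_derivs js smoothed_size x = (\<Sum>K'\<in>overlapping K. \<Sum>z\<in>Z K'.
           e K' / width K' ^ length js * bump (count_list js) z (width K') x)" (is ?eq)
    and "partial_derivs js smoothed_size differentiable (at x)" (is ?diff)
proof -
  have "open (reach K)" unfolding reach_def by (rule open_nbhd)
  note smooth = bump_sum_smooth[OF this smoothed_size_eq_sum_overlapping[OF assms(1)]]
  show ?diff by (rule smooth(2)) (use assms in auto)
  have "partial_derivs js smoothed_size x = (\<Sum>a\<in>Sigma (overlapping K) Z.
    e (fst a) / width (fst a) ^ length js * bump (count_list js) (snd a) (width (fst a)) x)"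
    by (rule smooth(1)) (use assms in auto)
  then show ?eq
    by (subst sum.Sigma)
       (use finite_overlapping[OF assms(1)] overlapping_subset Z(2) in \<open>auto simp: case_prod_beta\<close>)
qed

lemma smoothed_size_smooth: "finite \<T> \<Longrightarrow> C_inf_on UNIV smoothed_size"
  unfolding C_inf_on_def
  by (intro allI ballI bump_sum_smooth(2)[OF open_UNIV smoothed_size_eq_sum[of \<T>]]) auto

text \<open>At most \<open>M\<close> elements overlap with \<open>K\<close>, each contributes at most \<open>P\<close> nonzero bumps at \<open>x\<close>, and
  the coefficient of each of them is controlled by \<open>e K\<close> because overlapping elements have comparable
  sizes.\<close>

lemma partial_derivs_smoothed_size_bound:
  fixes B :: real and P :: nat
  assumes K: "K \<in> \<T>" "x \<in> reach K"
    and B: "0 \<le> B" "\<And>z s. \<bar>bump (count_list js) z s x\<bar> \<le> B"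
    and P: "\<And>t (v::real^'n) Z'. 0 < t \<Longrightarrow> Z' \<subseteq> cball v t \<Longrightarrow> separated (1 / (2 * CARD('n)) * t) Z' \<Longrightarrow> card Z' \<le> P"
  shows "\<bar>partial_derivs js smoothed_size x\<bar> \<le>
     real M * real P * B * C\<epsilon> ^ Suc (length js) * (CARD('n) / Creg) ^ length js * (e K / e K ^ length js)"
    (is "_ \<le> ?bound")
proof -
  let ?n = "length js"
  let ?w = "C\<epsilon> ^ Suc ?n * (CARD('n) / Creg) ^ ?n * (e K / e K ^ ?n)"
  have eK: "0 < e K" using K e_pos by auto
  have w: "0 \<le> ?w" using eK Creg_pos C\<epsilon>_ge_1 by auto
  have wB: "0 \<le> ?w * B" by (rule mult_nonneg_nonneg[OF w B(1)])
  have inner: "\<bar>\<Sum>z\<in>Z K'. e K' / width K' ^ ?n * bump (count_list js) z (width K') x\<bar> \<le> P * (?w * B)"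
    if K': "K' \<in> overlapping K" for K'
  proof -
    have K'T: "K' \<in> \<T>" using K' overlapping_subset by auto
    have eK': "0 < e K'" using e_pos K'T by auto
    have cmp: "e K' \<le> C\<epsilon> * e K" "e K \<le> C\<epsilon> * e K'"
      using comparable[of K K'] comparable[of K' K] K K'T K' by (auto simp: overlapping_def reach_def Int_commute)
    let ?Z = "{z \<in> Z K'. bump (count_list js) z (width K') x \<noteq> 0}"
    have "?Z \<subseteq> cball x (CARD('n) * width K')"
    proof
      fix p assume "p \<in> ?Z"
      then have "\<not> CARD('n) * width K' < dist p x"
        using bump_eq_0_far[OF width_pos[OF K'T], of p x "count_list js"] by blast
      then show "p \<in> cball x (CARD('n) * width K')" by (simp add: dist_commute)
    qed
    moreover have "separated (1 / (2 * CARD('n)) * (CARD('n) * width K')) ?Z"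
      using Z(3)[OF K'T] by (auto simp: separated_def width_def mult.commute[of 2])
    ultimately have card: "card ?Z \<le> P"
      using P[of "CARD('n) * width K'" ?Z x] width_pos[OF K'T] by auto
    have coeff: "e K' / width K' ^ ?n \<le> ?w"
    proof -
      have "1 / width K' = CARD('n) / Creg * (1 / e K')" by (simp add: width_def)
      also have "\<dots> \<le> CARD('n) / Creg * (C\<epsilon> / e K)"
        using cmp eK eK' Creg_pos by (intro mult_left_mono) (auto simp: field_simps)
      finally have "(1 / width K') ^ ?n \<le> (CARD('n) / Creg * (C\<epsilon> / e K)) ^ ?n"
        using width_pos[OF K'T] by (intro power_mono) auto
      then have "e K' * (1 / width K') ^ ?n \<le> C\<epsilon> * e K * (CARD('n) / Creg * (C\<epsilon> / e K)) ^ ?n"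
        using cmp eK' eK C\<epsilon>_ge_1 width_pos[OF K'T] by (intro mult_mono) auto
      also have "\<dots> = ?w" by (simp add: power_mult_distrib power_divide field_simps)
      finally show ?thesis by (simp add: power_divide)
    qed
    have summand: "\<bar>e K' / width K' ^ ?n * bump (count_list js) z (width K') x\<bar> \<le> ?w * B" for z
    proof -
      have "\<bar>e K' / width K' ^ ?n\<bar> \<le> ?w" using coeff eK' width_pos[OF K'T] by simp
      then show ?thesis unfolding abs_mult using B(2) w by (rule mult_mono) simp
    qed
    have "\<bar>\<Sum>z\<in>Z K'. e K' / width K' ^ ?n * bump (count_list js) z (width K') x\<bar>
      = \<bar>\<Sum>z\<in>?Z. e K' / width K' ^ ?n * bump (count_list js) z (width K') x\<bar>"
      using Z(2)[OF K'T] by (intro arg_cong[of _ _ abs] sum.mono_neutral_right) auto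
    also have "\<dots> \<le> (\<Sum>z\<in>?Z. ?w * B)"
      by (intro order_trans[OF sum_abs] sum_mono summand)
    also have "\<dots> \<le> P * (?w * B)"
      unfolding sum_constant by (rule mult_right_mono[OF _ wB]) (use card in simp)
    finally show ?thesis .
  qed
  have "\<bar>partial_derivs js smoothed_size x\<bar> \<le> (\<Sum>K'\<in>overlapping K. P * (?w * B))"
    unfolding partial_derivs_smoothed_size(1)[OF K] by (intro order_trans[OF sum_abs] sum_mono inner)
  also have "\<dots> = card (overlapping K) * (P * (?w * B))" by (rule sum_constant)
  also have "\<dots> \<le> M * (P * (?w * B))"
    by (rule mult_right_mono[OF _ mult_nonneg_nonneg[OF _ wB]]) (use card_overlapping[OF K(1)] in auto)
  finally show ?thesis by (simp only: mult_ac)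
qed

text \<open>All summands are nonnegative, and some centre in \<open>Z K\<close> is so close to \<open>x\<close> that its bump alone
  suffices.\<close>

lemma smoothed_size_lower_bound:
  assumes K: "K \<in> \<T>" "x \<in> closure K"
  shows "exp (- 4) ^ CARD('n) * e K \<le> smoothed_size x"
proof -
  have x: "x \<in> reach K" using K by (rule in_reach)
  obtain z where z: "z \<in> Z K" "dist z x \<le> width K / 2"
    using Z(4)[OF K] by (auto simp: width_def)
  have "K \<in> overlapping K" using x K by (auto simp: overlapping_def)
  have "exp (- 4) ^ CARD('n) * e K \<le> e K * bump (\<lambda>_. 0) z (width K) x"
    using bump_lower_bound[OF width_pos[OF K(1)] z(2)] e_pos[OF K(1)] by (simp add: mult.commute)
  also have "\<dots> = (\<Sum>a\<in>{(K, z)}. e (fst a) * bump (\<lambda>_. 0) (snd a) (width (fst a)) x)" by simp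
  also have "\<dots> \<le> smoothed_size x"
    unfolding smoothed_size_eq_sum_overlapping[OF K(1) x]
  proof (rule sum_mono2)
    show "finite (Sigma (overlapping K) Z)"
      using finite_overlapping[OF K(1)] overlapping_subset Z(2) by (intro finite_SigmaI) auto
    show "{(K, z)} \<subseteq> Sigma (overlapping K) Z" using \<open>K \<in> overlapping K\<close> z(1) by simp
    fix a assume "a \<in> Sigma (overlapping K) Z - {(K, z)}"
    then have "fst a \<in> overlapping K" by auto
    then have "fst a \<in> \<T>" using overlapping_subset by blast
    then show "0 \<le> e (fst a) * bump (\<lambda>_. 0) (snd a) (width (fst a)) x"
      using e_pos by (simp add: bump_nonneg less_imp_le)
  qed
  finally show ?thesis .
qed

end

lemma ex_list_with_counts:
  fixes r :: "'a::finite \<Rightarrow> nat"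
  shows "\<exists>js. \<forall>i. count_list js i = r i"
proof -
  obtain js where "mset js = (\<Sum>i\<in>UNIV. replicate_mset (r i) i)" using ex_mset by blast
  then have "count_list js i = r i" for i
    by (simp add: count_sum flip: count_mset)
  then show ?thesis by blast
qed

text \<open>The hypotheses of part (i) with the piecewise constant function replaced by its values; \<open>N\<close> bounds
  the sizes. The bound is imposed on nonempty elements only, as the size attached to an empty element is
  not seen by any function on \<open>\<Omega>\<close>.\<close>

definition locally_comparable_sizes ::
    "(real^'n) set \<Rightarrow> real \<Rightarrow> real \<Rightarrow> real \<Rightarrow> nat \<Rightarrow> (real^'n) set set \<Rightarrow> ((real^'n) set \<Rightarrow> real) \<Rightarrow> bool" where
  "locally_comparable_sizes \<Omega> Creg C\<epsilon> N M \<T> e \<longleftrightarrow>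
     closure \<Omega> = (\<Union>K\<in>\<T>. closure K) \<and>
     (\<forall>K\<in>\<T>. bounded K \<and> 0 < e K \<and> (K \<noteq> {} \<longrightarrow> e K \<le> N)) \<and>
     (\<forall>K\<in>\<T>. finite {K'\<in>\<T>. nbhd K (Creg * e K) \<inter> nbhd K' (Creg * e K') \<noteq> {}} \<and>
             card {K'\<in>\<T>. nbhd K (Creg * e K) \<inter> nbhd K' (Creg * e K') \<noteq> {}} \<le> M) \<and>
     (\<forall>K\<in>\<T>. \<forall>K'\<in>\<T>. nbhd K (Creg * e K) \<inter> nbhd K' (Creg * e K') \<noteq> {} \<longrightarrow> e K \<le> C\<epsilon> * e K')"

text \<open>On \<open>closure K\<close> the smoothed size is comparable to \<open>e K\<close>, so the bounds of the
  derivatives in terms of \<open>e K\<close> turn into bounds in terms of \<open>\<epsilon> x\<close> at the cost of powers of \<open>C\<close>. For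
  the Lipschitz bound between \<open>x\<close> and \<open>y\<close> there are two cases: if one of the points lies in the ball of
  radius \<open>Creg * e K\<close> around the other, the gradient bound on this ball applies; otherwise both values are
  at most a constant times the distance.\<close>

lemma exists_length_scale:
  fixes \<Omega> :: "(real^'n) set" and Creg C\<epsilon> N :: real and M :: nat
  assumes Creg: "0 < Creg"
  shows "\<exists>C L (\<Lambda> :: ('n \<Rightarrow> nat) \<Rightarrow> real). 0 < C \<and>
     (\<forall>\<T> e. locally_comparable_sizes \<Omega> Creg C\<epsilon> N M \<T> e \<longrightarrow>
     (\<exists>\<epsilon>. admissible_length_scale \<Omega> (L, \<Lambda>) \<epsilon> \<and> (\<forall>x\<in>closure \<Omega>. 0 < \<epsilon> x) \<and>
          (\<forall>K\<in>\<T>. comparable_on C K \<epsilon> (e K)) \<and> (finite \<T> \<longrightarrow> C_inf_on UNIV \<epsilon>)))"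
proof -
  define d where "d = real CARD('n)"
  have d: "0 < d" by (simp add: d_def)
  obtain B where B: "\<And>k. 0 \<le> B k" "\<And>k z s x. \<bar>bump (k::'n\<Rightarrow>nat) z s x\<bar> \<le> B k"
    using bump_bounded by metis
  have "0 < 1 / (2 * d)" using d by simp
  from separated_card_bounded[OF this, where 'a = "real^'n"]
  obtain P where P: "\<And>t (v::real^'n) Z. 0 < t \<Longrightarrow> Z \<subseteq> cball v t \<Longrightarrow> separated (1 / (2 * d) * t) Z \<Longrightarrow> card Z \<le> P"
    by blast
  define c1 where "c1 = max C\<epsilon> 1"
  define G where "G js = real M * real P * B (count_list js) * c1 ^ Suc (length js) * (d / Creg) ^ length js" for js :: "'n list"
  have G: "0 \<le> G js" for js
    unfolding G_def using B d Creg by (intro mult_nonneg_nonneg zero_le_power) (auto simp: c1_def)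
  define c0 :: real where "c0 = exp (- 4) ^ CARD('n)"
  have c0: "0 < c0" by (simp add: c0_def)
  define C where "C = G [] + 1 / c0"
  have C: "0 < C" using c0 G[of "[]"] by (simp add: C_def add_nonneg_pos)
  have "1 / c0 \<le> C" using G[of "[]"] by (simp add: C_def)
  then have invC: "inverse C \<le> c0" using c0 C by (simp add: field_simps)
  define js where "js r = (SOME js. \<forall>i. count_list js i = r i)" for r :: "'n \<Rightarrow> nat"
  have "count_list (js r) i = r i" for r i
    using someI_ex[OF ex_list_with_counts[of r]] by (simp add: js_def)
  then have length_js: "length (js r) = mindex_order r" for r
    using sum_count_set[of "js r" UNIV] by (simp add: mindex_order_def)
  \<comment> \<open>The second summand makes the value for the zero multi-index an upper bound for the function itself.\<close>
  define \<Lambda> where "\<Lambda> r = G (js r) * C ^ Suc (mindex_order r) + \<bar>C * N\<bar>" for r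
  define G1 where "G1 = (\<Sum>i\<in>UNIV. G [i])"
  have G1: "G [i] \<le> G1" for i unfolding G1_def using G by (intro member_le_sum) auto
  have G1_nonneg: "0 \<le> G1" using G by (auto simp: G1_def intro: sum_nonneg)
  define L where "L = d * G1 + C / Creg"
  have L: "0 \<le> L" using d G1_nonneg C Creg by (simp add: L_def)
  have main: "\<exists>\<epsilon>. admissible_length_scale \<Omega> (L, \<Lambda>) \<epsilon> \<and> (\<forall>x\<in>closure \<Omega>. 0 < \<epsilon> x) \<and>
          (\<forall>K\<in>\<T>. comparable_on C K \<epsilon> (e K)) \<and> (finite \<T> \<longrightarrow> C_inf_on UNIV \<epsilon>)"
    if hyp: "locally_comparable_sizes \<Omega> Creg C\<epsilon> N M \<T> e" for \<T> e
  proof -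
    note T = hyp[unfolded locally_comparable_sizes_def, THEN conjunct1]
      hyp[unfolded locally_comparable_sizes_def, THEN conjunct2, THEN conjunct1, rule_format]
      hyp[unfolded locally_comparable_sizes_def, THEN conjunct2, THEN conjunct2, THEN conjunct1, rule_format]
      hyp[unfolded locally_comparable_sizes_def, THEN conjunct2, THEN conjunct2, THEN conjunct2, rule_format]
    have "\<exists>Z\<subseteq>K. finite Z \<and> separated (Creg * e K / d / 2) Z \<and> (\<forall>x\<in>closure K. \<exists>z\<in>Z. dist z x \<le> Creg * e K / d / 2)"
      if "K \<in> \<T>" for K
      using T(2)[OF that] Creg d by (intro maximal_separated_subset) auto
    then obtain Z where Z: "\<And>K. K \<in> \<T> \<Longrightarrow> Z K \<subseteq> K \<and> finite (Z K) \<and> separated (Creg * e K / d / 2) (Z K) \<and>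
        (\<forall>x\<in>closure K. \<exists>z\<in>Z K. dist z x \<le> Creg * e K / d / 2)"
      by metis
    have cmp: "e K \<le> c1 * e K'"
      if "K \<in> \<T>" "K' \<in> \<T>" "nbhd K (Creg * e K) \<inter> nbhd K' (Creg * e K') \<noteq> {}" for K K'
    proof -
      have "C\<epsilon> * e K' \<le> c1 * e K'" using T(2)[OF that(2)] by (simp add: c1_def)
      with T(4)[OF that] show ?thesis by simp
    qed
    interpret length_scale_data \<T> e Creg c1 M Z
      using Creg T(2,3) Z cmp by unfold_locales (auto simp: c1_def d_def)
    have bound: "\<bar>partial_derivs js smoothed_size x\<bar> \<le> G js * (e K / e K ^ length js)"
      if "K \<in> \<T>" "x \<in> reach K" for K x js
      unfolding G_def d_def using that B P unfolding d_def by (intro partial_derivs_smoothed_size_bound) auto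
    have up: "smoothed_size x \<le> C * e K" if K: "K \<in> \<T>" "x \<in> closure K" for K x
    proof -
      have "smoothed_size x \<le> G [] * e K"
        using bound[of K x "[]"] in_reach[OF K] K by (simp add: partial_derivs_def abs_le_iff)
      also have "\<dots> \<le> C * e K" using e_pos[OF K(1)] c0 by (simp add: C_def)
      finally show ?thesis .
    qed
    have low: "inverse C * e K \<le> smoothed_size x" if K: "K \<in> \<T>" "x \<in> closure K" for K x
    proof -
      have "inverse C * e K \<le> c0 * e K" using invC e_pos[OF K(1)] by simp
      with smoothed_size_lower_bound[OF K] show ?thesis by (simp add: c0_def)
    qed
    have pos: "0 < smoothed_size x" if K: "K \<in> \<T>" "x \<in> closure K" for K x
      using low[OF K] e_pos[OF K(1)] C by (meson less_le_trans mult_pos_pos positive_imp_inverse_positive)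
    have cover: "\<exists>K\<in>\<T>. x \<in> closure K" if "x \<in> \<Omega>" for x
      using that closure_subset T(1) by blast
    have multi: "\<bar>multi_deriv r smoothed_size x\<bar> \<le> \<Lambda> r * \<bar>smoothed_size x\<bar> powi (1 - int (mindex_order r))" if x: "x \<in> \<Omega>" for r x
    proof -
      obtain K where K: "K \<in> \<T>" "x \<in> closure K" using cover[OF x] by blast
      let ?m = "mindex_order r"
      have eK: "0 < e K" using e_pos K by simp
      have lx: "0 < smoothed_size x" using pos[OF K] .
      have a: "e K \<le> C * smoothed_size x" using low[OF K] C by (simp add: field_simps)
      have b: "1 / e K \<le> C / smoothed_size x" using up[OF K] lx eK by (simp add: field_simps)
      have pw: "\<bar>smoothed_size x\<bar> powi (1 - int ?m) = smoothed_size x * (1 / smoothed_size x) ^ ?m"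
        using lx by (simp add: power_int_diff power_divide)
      have "e K * (1 / e K) ^ ?m \<le> C * smoothed_size x * (C / smoothed_size x) ^ ?m"
        using a b eK lx C by (intro mult_mono power_mono) auto
      also have "\<dots> = C ^ Suc ?m * (smoothed_size x * (1 / smoothed_size x) ^ ?m)"
        by (simp add: power_divide)
      finally have "e K / e K ^ ?m \<le> C ^ Suc ?m * (smoothed_size x * (1 / smoothed_size x) ^ ?m)"
        by (simp add: power_divide)
      then have "G (js r) * (e K / e K ^ ?m) \<le> G (js r) * (C ^ Suc ?m * (smoothed_size x * (1 / smoothed_size x) ^ ?m))"
        using G by (rule mult_left_mono)
      also have "\<dots> \<le> \<Lambda> r * (smoothed_size x * (1 / smoothed_size x) ^ ?m)"
        using lx unfolding \<Lambda>_def mult.assoc[symmetric] by (intro mult_right_mono) (auto simp: ac_simps)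
      finally show ?thesis
        using bound[of K x "js r"] in_reach[OF K] K unfolding length_js pw
        by (simp add: multi_deriv_def js_def)
    qed
    have lip: "\<bar>smoothed_size x - smoothed_size y\<bar> \<le> L * norm (x - y)" if x: "x \<in> \<Omega>" and y: "y \<in> \<Omega>" for x y
    proof -
      have near: ?thesis if K: "K \<in> \<T>" "w \<in> closure K" and xy: "x \<in> ball w (Creg * e K)" "y \<in> ball w (Creg * e K)" for K w
      proof -
        have sub: "z \<in> reach K" if "z \<in> ball w (Creg * e K)" for z
          using ball_subset_reach[OF K(2)] that by blast
        have "\<bar>smoothed_size x - smoothed_size y\<bar> \<le> real CARD('n) * G1 * norm (x - y)"
        proof (rule partial_derivs_bounded_imp_lipschitz[OF convex_ball _ _ xy])
          fix z assume z: "z \<in> ball w (Creg * e K)"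
          show "smoothed_size differentiable (at z)"
            using partial_derivs_smoothed_size(2)[OF K(1) sub[OF z], of "[]"] by (simp add: partial_derivs_def)
          show "\<bar>partial_deriv i smoothed_size z\<bar> \<le> G1" for i
            using bound[OF K(1) sub[OF z], of "[i]"] G1[of i] e_pos[OF K(1)] by (simp add: partial_derivs_def)
        qed
        also have "\<dots> \<le> L * norm (x - y)"
          using C Creg by (intro mult_right_mono) (auto simp: L_def d_def)
        finally show ?thesis .
      qed
      obtain K K' where K: "K \<in> \<T>" "x \<in> closure K" and K': "K' \<in> \<T>" "y \<in> closure K'"
        using cover x y by blast
      show ?thesis
      proof (cases "dist x y < Creg * e K \<or> dist y x < Creg * e K'")
        case True
        then show ?thesis
          using near[OF K] near[OF K'] e_pos K K' Creg by (auto simp: dist_commute)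
      next
        case False
        then have far: "e K \<le> norm (x - y) / Creg" "e K' \<le> norm (x - y) / Creg"
          using Creg by (auto simp: dist_norm norm_minus_commute field_simps)
        have "\<bar>smoothed_size x - smoothed_size y\<bar> \<le> max (smoothed_size x) (smoothed_size y)" using pos[OF K] pos[OF K'] by auto
        also have "\<dots> \<le> C * (norm (x - y) / Creg)"
          using up[OF K] up[OF K'] mult_left_mono[OF far(1), of C] mult_left_mono[OF far(2), of C] C by auto
        also have "\<dots> \<le> L * norm (x - y)"
          using d G1_nonneg by (simp add: L_def field_simps)
        finally show ?thesis .
      qed
    qed
    have "admissible_length_scale \<Omega> (L, \<Lambda>) smoothed_size"
      unfolding admissible_length_scale_def prod.case
    proof (intro conjI allI ballI)
      show "0 \<le> \<Lambda> r" for r using G C by (simp add: \<Lambda>_def)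
      show "C_inf_on \<Omega> smoothed_size"
        unfolding C_inf_on_def using cover partial_derivs_smoothed_size(2) in_reach by blast
      fix x assume x: "x \<in> \<Omega>"
      then obtain K where K: "K \<in> \<T>" "x \<in> closure K" using cover by blast
      show "0 < smoothed_size x" using pos[OF K] .
      have "K \<noteq> {}" using K by auto
      have "smoothed_size x \<le> C * N"
        using up[OF K] T(2)[OF K(1)] \<open>K \<noteq> {}\<close> C by (meson mult_left_mono less_imp_le order_trans)
      also have "\<dots> \<le> \<Lambda> (\<lambda>_. 0)" 
        using G[of "js (\<lambda>_. 0)"] C by (auto simp: \<Lambda>_def intro: order_trans[OF abs_ge_self])
      finally show "smoothed_size x \<le> \<Lambda> (\<lambda>_. 0)" .
      show "\<bar>multi_deriv r smoothed_size x\<bar> \<le> \<Lambda> r * \<bar>smoothed_size x\<bar> powi (1 - int (mindex_order r))" for r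
        by (rule multi[OF x])
    next
      show "L-lipschitz_on \<Omega> smoothed_size"
        using lip L by (auto intro!: lipschitz_onI simp: dist_norm)
    qed (rule L)
    moreover have "0 < smoothed_size x" if "x \<in> closure \<Omega>" for x using that T(1) pos by auto
    moreover have "comparable_on C K smoothed_size (e K)" if "K \<in> \<T>" for K
      using low[OF that] up[OF that] closure_subset[of K] unfolding comparable_on_def by blast
    ultimately show ?thesis using smoothed_size_smooth by (intro exI[of _ smoothed_size] conjI ballI impI) auto
  qed
  then show ?thesis
    using C by (intro exI[of _ C] exI[of _ L] exI[of _ \<Lambda>] conjI allI impI) (assumption | rule main)+
qed

section \<open>Elements of a partition\<close>

text \<open>Elements are contained in \<open>closure \<Omega>\<close>, not visibly in \<open>\<Omega>\<close>. As an open set meeting the closure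
  of \<open>\<Omega>\<close> meets \<open>\<Omega>\<close>, points of an element can always be moved slightly into \<open>\<Omega>\<close>.\<close>

lemma partition_element_meets_domain:
  assumes "is_partition \<Omega> \<T>" "K \<in> \<T>" "x \<in> closure K" "0 < r"
  shows "K \<inter> \<Omega> \<inter> ball x r \<noteq> {}"
proof -
  have K: "open K" "K \<subseteq> closure \<Omega>"
    using assms(1,2) closure_subset[of K] unfolding is_partition_def by blast+
  have "K \<inter> ball x r \<noteq> {}"
    using assms(3,4) unfolding closure_approachable by (metis Int_iff dist_commute empty_iff mem_ball)
  then obtain y where "y \<in> K \<inter> ball x r" by blast
  then have "\<Omega> \<inter> (K \<inter> ball x r) \<noteq> {}"
    using K open_Int_closure_eq_empty[OF open_Int[OF K(1) open_ball], of x r \<Omega>] by blast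
  then show ?thesis by (simp add: Int_ac)
qed

text \<open>Otherwise the nonempty open set \<open>U\<close> would be contained in a null set.\<close>

lemma open_set_value_le_Linf_norm:
  assumes \<Omega>: "open \<Omega>" and f: "Linf_norm \<Omega> f = ereal N"
    and U: "open U" "U \<subseteq> \<Omega>" "U \<noteq> {}" "\<And>x. x \<in> U \<Longrightarrow> f x = c"
  shows "c \<le> N"
proof (rule ccontr)
  assume "\<not> c \<le> N"
  from esssup_AE[of "\<lambda>x. ereal \<bar>f x\<bar>" "lebesgue_on \<Omega>"]
  have "AE x in lebesgue_on \<Omega>. ereal \<bar>f x\<bar> \<le> ereal N"
    using f by (simp add: Linf_norm_def)
  then have "AE x in lebesgue. x \<in> \<Omega> \<longrightarrow> \<bar>f x\<bar> \<le> N"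
    using \<Omega> by (subst (asm) AE_restrict_space_iff) auto
  then obtain S where S: "{x. \<not> (x \<in> \<Omega> \<longrightarrow> \<bar>f x\<bar> \<le> N)} \<subseteq> S" "S \<in> null_sets lebesgue"
    by (auto elim!: AE_E simp: null_sets_def)
  have "U \<subseteq> S" using S(1) U \<open>\<not> c \<le> N\<close> by fastforce
  then have "negligible U" using S(2) negligible_subset by (auto simp: negligible_iff_null_sets)
  then show False using U open_not_negligible by blast
qed

section \<open>Short paths in Lipschitz domains\<close>

text \<open>Three segments are what the local epigraphs provide: up, across and down. Keeping the path
  polygonal lets Lipschitz estimates be applied segment by segment.\<close>

definition joined_within :: "'a::euclidean_space set \<Rightarrow> real \<Rightarrow> 'a \<Rightarrow> 'a \<Rightarrow> bool" where
  "joined_within \<Omega> C x y \<longleftrightarrow> (\<exists>a b. closed_segment x a \<union> closed_segment a b \<union> closed_segment b y \<subseteq> \<Omega> \<and>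
      dist x a \<le> C * dist x y \<and> dist a b \<le> C * dist x y \<and> dist b y \<le> C * dist x y)"

lemma joined_within_connected_set:
  assumes "joined_within \<Omega> C x y" "1 \<le> C"
  shows "\<exists>S. connected S \<and> x \<in> S \<and> y \<in> S \<and> S \<subseteq> \<Omega> \<and> S \<subseteq> cball x (2 * C * dist x y)"
proof -
  obtain a b where ab: "closed_segment x a \<union> closed_segment a b \<union> closed_segment b y \<subseteq> \<Omega>"
    "dist x a \<le> C * dist x y" "dist a b \<le> C * dist x y" "dist b y \<le> C * dist x y"
    using assms(1) unfolding joined_within_def by blast
  let ?S = "closed_segment x a \<union> closed_segment a b \<union> closed_segment b y"
  have "connected ?S" by (intro connected_Un) auto
  moreover have "?S \<subseteq> cball x (2 * C * dist x y)"
  proof -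
    have "1 * dist x y \<le> C * dist x y" using assms(2) by (intro mult_right_mono) auto
    moreover have "0 \<le> C * dist x y" using assms(2) by simp
    ultimately have "{x, a, b, y} \<subseteq> cball x (2 * C * dist x y)"
      using ab(2-4) dist_triangle[of x b a] by auto
    then show ?thesis by (simp add: closed_segment_subset)
  qed
  ultimately show ?thesis using ab(1) by (intro exI[of _ ?S]) auto
qed

text \<open>Moving up by \<open>t = L * dist x y\<close> from \<open>x\<close> and from \<open>y\<close> stays in the epigraph and lifts both points
  so high that the segment between the lifted points lies above the graph: the graph rises by at most
  \<open>L * dist x y\<close> between them. The radius \<open>\<rho>\<close> is chosen so that this path stays in \<open>ball z r\<close>.\<close>

lemma lipschitz_epigraph_locally_connected:
  fixes \<Omega> :: "(real^'n) set"
  assumes "norm \<nu> = 1" "0 < r" and g: "L-lipschitz_on {y. y \<bullet> \<nu> = 0} g"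
    and \<Omega>: "\<Omega> \<inter> ball z r = {y \<in> ball z r. g (y - (y \<bullet> \<nu>) *\<^sub>R \<nu>) < y \<bullet> \<nu>}"
  shows "\<exists>\<rho>>0. \<exists>C. \<forall>x\<in>\<Omega> \<inter> ball z \<rho>. \<forall>y\<in>\<Omega> \<inter> ball z \<rho>. joined_within \<Omega> C x y"
proof -
  define \<rho> where "\<rho> = r / 2 / (1 + 2 * L)"
  have L: "0 \<le> L" using g lipschitz_on_nonneg by blast
  have "\<rho> * (1 + 2 * L) = r / 2"
    unfolding \<rho>_def using L by (subst nonzero_eq_divide_eq[symmetric]) auto
  then have \<rho>: "0 < \<rho>" "\<rho> + 2 * L * \<rho> < r"
    using L assms(2) by (simp add: \<rho>_def, simp add: algebra_simps)
  define h where "h y = g (y - (y \<bullet> \<nu>) *\<^sub>R \<nu>)" for y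
  have \<nu>\<nu>: "\<nu> \<bullet> \<nu> = 1" using assms(1) by (simp add: norm_eq_1)
  have h_shift: "h (y + s *\<^sub>R \<nu>) = h y" for y s
    by (simp add: h_def inner_add_left algebra_simps \<nu>\<nu>)
  \<comment> \<open>The orthogonal projection along the axis does not increase distances.\<close>
  have h_lip: "h y \<le> h y' + L * dist y y'" for y y'
  proof -
    let ?p = "\<lambda>y. y - (y \<bullet> \<nu>) *\<^sub>R \<nu>"
    have orth: "?p y \<bullet> \<nu> = 0" for y by (simp add: inner_diff_left \<nu>\<nu>)
    have "(norm (?p w))\<^sup>2 \<le> (norm w)\<^sup>2" for w
    proof -
      have "(norm (?p w))\<^sup>2 = w \<bullet> w - (w \<bullet> \<nu>)\<^sup>2"
        unfolding power2_norm_eq_inner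
        by (simp add: inner_diff_left inner_diff_right \<nu>\<nu> inner_commute power2_eq_square)
      then show ?thesis by (simp add: power2_norm_eq_inner)
    qed
    then have "norm (?p w) \<le> norm w" for w by (rule power2_le_imp_le) simp
    from this[of "y - y'"] have "dist (?p y) (?p y') \<le> dist y y'"
      by (simp add: dist_norm inner_diff_left algebra_simps)
    moreover have "dist (h y) (h y') \<le> L * dist (?p y) (?p y')"
      unfolding h_def using orth by (intro lipschitz_onD[OF g]) auto
    ultimately have "dist (h y) (h y') \<le> L * dist y y'"
      using L by (meson mult_left_mono order_trans)
    then show ?thesis by (simp add: dist_real_def abs_le_iff)
  qed
  have "joined_within \<Omega> (max L 1) x y"
    if x: "x \<in> \<Omega> \<inter> ball z \<rho>" and y: "y \<in> \<Omega> \<inter> ball z \<rho>" for x y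
  proof -
    define t where "t = L * dist x y"
    have "dist x y < 2 * \<rho>" using x y dist_triangle_less_add[of x z \<rho> y \<rho>] by (simp add: dist_commute)
    then have t: "0 \<le> t" "\<rho> + t < r"
      using L \<rho> mult_left_mono[of "dist x y" "2 * \<rho>" L] by (auto simp: t_def)
    have mem: "w \<in> \<Omega>" if "w \<in> ball z r" "h w < w \<bullet> \<nu>" for w
      using that \<Omega> by (auto simp: h_def)
    have "\<rho> < r" using t by simp
    then have hx: "h x < x \<bullet> \<nu>" and hy: "h y < y \<bullet> \<nu>"
      using x y \<Omega> subset_ball[of \<rho> r z] unfolding h_def by fastforce+
    have up: "closed_segment w (w + t *\<^sub>R \<nu>) \<subseteq> \<Omega>" if w: "w \<in> ball z \<rho>" "h w < w \<bullet> \<nu>" for w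
    proof
      fix v assume "v \<in> closed_segment w (w + t *\<^sub>R \<nu>)"
      then obtain u where u: "0 \<le> u" "u \<le> 1" "v = w + (u * t) *\<^sub>R \<nu>"
        by (auto simp: in_segment algebra_simps)
      have "u * t \<le> t" using u t by (simp add: mult_left_le_one_le)
      have "dist z v \<le> dist z w + u * t"
        using u t assms(1) dist_triangle[of z v w] by (simp add: dist_norm)
      then have "v \<in> ball z r" using w \<open>u * t \<le> t\<close> t by simp
      moreover have "h v < v \<bullet> \<nu>"
        using w(2) mult_nonneg_nonneg[OF u(1) t(1)] by (simp add: u(3) h_shift inner_add_left \<nu>\<nu>)
      ultimately show "v \<in> \<Omega>" by (rule mem)
    qed
    have across: "closed_segment (x + t *\<^sub>R \<nu>) (y + t *\<^sub>R \<nu>) \<subseteq> \<Omega>"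
    proof
      fix v assume "v \<in> closed_segment (x + t *\<^sub>R \<nu>) (y + t *\<^sub>R \<nu>)"
      then obtain u where u: "0 \<le> u" "u \<le> 1" and v0: "v = (1 - u) *\<^sub>R (x + t *\<^sub>R \<nu>) + u *\<^sub>R (y + t *\<^sub>R \<nu>)"
        by (auto simp: in_segment)
      define w where "w = (1 - u) *\<^sub>R x + u *\<^sub>R y"
      have v: "v = w + t *\<^sub>R \<nu>" by (simp add: v0 w_def algebra_simps)
      have "w \<in> ball z \<rho>"
        unfolding w_def using x y u by (intro convexD_alt[OF convex_ball]) auto
      then have "v \<in> ball z r"
        using t assms(1) dist_triangle[of z v w] by (simp add: v dist_norm)
      have "w - x = u *\<^sub>R (y - x)" "w - y = (1 - u) *\<^sub>R (x - y)" by (simp_all add: w_def algebra_simps)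
      then have "dist w x = u * dist x y" "dist w y = (1 - u) * dist x y"
        using u by (simp_all add: dist_norm norm_minus_commute)
      then have "h w < x \<bullet> \<nu> + L * (u * dist x y)" "h w < y \<bullet> \<nu> + L * ((1 - u) * dist x y)"
        using h_lip[of w x] h_lip[of w y] hx hy by auto
      then have "h w < x \<bullet> \<nu> + u * t" "h w < y \<bullet> \<nu> + (1 - u) * t"
        by (simp_all add: t_def mult_ac)
      \<comment> \<open>The bounds of the height function from the two end points are averaged with the weights of the convex combination.\<close>
      then have "(1 - u) * h w + u * h w < (1 - u) * (x \<bullet> \<nu> + u * t) + u * (y \<bullet> \<nu> + (1 - u) * t)"
      proof (cases "u = 0")
        case False
        show ?thesis
          by (intro add_le_less_mono mult_left_mono mult_strict_left_mono)
             (use u False \<open>h w < x \<bullet> \<nu> + u * t\<close> \<open>h w < y \<bullet> \<nu> + (1 - u) * t\<close> in auto)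
      qed simp
      also have "\<dots> = w \<bullet> \<nu> + 2 * (u * (1 - u)) * t"
        by (simp add: w_def inner_add_left algebra_simps)
      also have "\<dots> \<le> w \<bullet> \<nu> + 1 * t"
      proof (intro add_left_mono mult_right_mono)
        have "0 \<le> (1 - u)\<^sup>2 + u\<^sup>2" by simp
        then show "2 * (u * (1 - u)) \<le> 1" by (simp add: power2_eq_square algebra_simps)
      qed (rule t)
      also have "(1 - u) * h w + u * h w = h v" by (simp add: v h_shift algebra_simps)
      also have "w \<bullet> \<nu> + 1 * t = v \<bullet> \<nu>" by (simp add: v inner_add_left \<nu>\<nu>)
      finally show "v \<in> \<Omega>" by (rule mem[OF \<open>v \<in> ball z r\<close>])
    qed
    have "dist x (x + t *\<^sub>R \<nu>) = t" "dist (y + t *\<^sub>R \<nu>) y = t" "dist (x + t *\<^sub>R \<nu>) (y + t *\<^sub>R \<nu>) = dist x y"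
      using t assms(1) by (simp_all add: dist_norm)
    moreover have "t \<le> max L 1 * dist x y" "dist x y \<le> max L 1 * dist x y"
      using mult_right_mono[of L "max L 1" "dist x y"] mult_right_mono[of 1 "max L 1" "dist x y"]
      by (simp_all add: t_def)
    ultimately show ?thesis
      unfolding joined_within_def using up[of x] up[of y] across x y hx hy
      by (intro exI[of _ "x + t *\<^sub>R \<nu>"] exI[of _ "y + t *\<^sub>R \<nu>"])
         (auto simp: closed_segment_commute)
  qed
  with \<rho>(1) show ?thesis by blast
qed

text \<open>By compactness finitely many of the neighbourhoods given by convex balls at interior points and by
  epigraphs at boundary points suffice. Half radii in the cover leave room for the second point.\<close>

lemma bounded_lipschitz_domain_locally_quasiconvex:
  fixes \<Omega> :: "(real^'n) set"
  assumes \<Omega>: "bounded_lipschitz_domain \<Omega>"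
  shows "\<exists>\<delta>>0. \<exists>C\<ge>1. \<forall>x\<in>\<Omega>. \<forall>y\<in>\<Omega>. dist x y < \<delta> \<longrightarrow> joined_within \<Omega> C x y"
proof -
  have joined_mono: "joined_within \<Omega> C x y \<Longrightarrow> C \<le> C' \<Longrightarrow> joined_within \<Omega> C' x y" for C C' x y
    unfolding joined_within_def by (meson mult_right_mono order_trans zero_le_dist)
  have "\<exists>\<rho>>0. \<exists>C. \<forall>x\<in>\<Omega> \<inter> ball z \<rho>. \<forall>y\<in>\<Omega> \<inter> ball z \<rho>. joined_within \<Omega> C x y" if z: "z \<in> closure \<Omega>" for z
  proof (cases "z \<in> \<Omega>")
    case True
    then obtain \<rho> where \<rho>: "0 < \<rho>" "ball z \<rho> \<subseteq> \<Omega>"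
      using \<Omega> by (meson bounded_lipschitz_domain_def openE)
    have "joined_within \<Omega> 1 x y" if "x \<in> ball z \<rho>" "y \<in> ball z \<rho>" for x y
    proof -
      have "closed_segment x y \<subseteq> \<Omega>"
        using closed_segment_subset[OF that convex_ball] \<rho> by blast
      then show ?thesis unfolding joined_within_def using that \<rho> by (intro exI[of _ x] exI[of _ y]) auto
    qed
    with \<rho> show ?thesis by blast
  next
    case False
    then have "z \<in> frontier \<Omega>"
      using z \<Omega> by (simp add: frontier_def bounded_lipschitz_domain_def interior_open)
    then obtain \<nu> r L g where "norm \<nu> = 1" "0 < r" "L-lipschitz_on {y. y \<bullet> \<nu> = 0} g"
        "\<Omega> \<inter> ball z r = {y \<in> ball z r. g (y - (y \<bullet> \<nu>) *\<^sub>R \<nu>) < y \<bullet> \<nu>}"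
      using \<Omega> unfolding bounded_lipschitz_domain_def by blast
    then show ?thesis
      by (rule lipschitz_epigraph_locally_connected)
  qed
  then obtain \<rho> C where \<rho>: "\<And>z. z \<in> closure \<Omega> \<Longrightarrow> 0 < \<rho> z"
    and C: "\<And>z x y. z \<in> closure \<Omega> \<Longrightarrow> x \<in> \<Omega> \<inter> ball z (\<rho> z) \<Longrightarrow> y \<in> \<Omega> \<inter> ball z (\<rho> z) \<Longrightarrow> joined_within \<Omega> (C z) x y"
    by metis
  have cpt: "compact (closure \<Omega>)" using \<Omega> by (simp add: bounded_lipschitz_domain_def)
  have cov: "closure \<Omega> \<subseteq> (\<Union>z\<in>closure \<Omega>. ball z (\<rho> z / 2))" using \<rho> by force
  obtain D where D: "D \<subseteq> closure \<Omega>" "finite D" "closure \<Omega> \<subseteq> (\<Union>z\<in>D. ball z (\<rho> z / 2))"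
    by (rule compactE_image[OF cpt _ cov]) auto
  have "D \<noteq> {}" using D(3) \<Omega> closure_subset[of \<Omega>] by (auto simp: bounded_lipschitz_domain_def)
  define \<delta> where "\<delta> = Min ((\<lambda>z. \<rho> z / 2) ` D)"
  define C' where "C' = Max (insert 1 (C ` D))"
  have "0 < \<delta>" unfolding \<delta>_def using D(1,2) \<open>D \<noteq> {}\<close> \<rho> by (subst Min_gr_iff) auto
  moreover have "1 \<le> C'" unfolding C'_def using D(2) by simp
  moreover have "joined_within \<Omega> C' x y" if xy: "x \<in> \<Omega>" "y \<in> \<Omega>" "dist x y < \<delta>" for x y
  proof -
    obtain z where z: "z \<in> D" "dist z x < \<rho> z / 2"
      using D(3) xy(1) closure_subset[of \<Omega>] by fastforce
    have "\<delta> \<le> \<rho> z / 2" unfolding \<delta>_def using z D(2) by (intro Min_le) auto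
    then have "dist z y < \<rho> z" using dist_triangle[of z y x] z xy(3) by linarith
    moreover have "dist z x < \<rho> z" using z(2) \<rho>[of z] z(1) D(1) by auto
    ultimately have "joined_within \<Omega> (C z) x y" using z(1) D(1) xy by (intro C[of z]) auto
    moreover have "C z \<le> C'" unfolding C'_def using z D(2) by (intro Max_ge) auto
    ultimately show ?thesis by (rule joined_mono)
  qed
  ultimately show ?thesis by blast
qed

section \<open>Shape-regular simplicial meshes\<close>

lemma closure_affine_image:
  fixes A :: "real^'n^'n"
  assumes "invertible A"
  shows "closure ((\<lambda>x. A *v x + b) ` S) = (\<lambda>x. A *v x + b) ` closure S"
proof -
  have "(\<lambda>x. A *v x + b) ` U = (\<lambda>x. b + x) ` ((*v) A ` U)" for U by (auto simp: image_image add.commute)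
  moreover have "inj ((*v) A)" using assms by (simp add: inj_matrix_vector_mult)
  ultimately show ?thesis
    by (simp add: closure_translation closure_injective_linear_image[OF matrix_vector_mul_linear])
qed

lemma convex_hull_affine_image:
  fixes A :: "real^'n^'n"
  shows "convex hull ((\<lambda>x. A *v x + b) ` S) = (\<lambda>x. A *v x + b) ` (convex hull S)"
proof -
  have "(\<lambda>x. A *v x + b) ` U = (\<lambda>x. b + x) ` ((*v) A ` U)" for U by (auto simp: image_image add.commute)
  then show ?thesis
    by (simp only: convex_hull_translation convex_hull_linear_image[OF matrix_vector_mul_linear])
qed

text \<open>A ball inside the image shows that the linear part reaches a positive multiple of every vector.\<close>

lemma affine_image_onto_open_imp_invertible:
  fixes A :: "real^'n^'n"
  assumes "open K" "K \<noteq> {}" "K = (\<lambda>x. A *v x + b) ` S"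
  shows "invertible A"
proof -
  obtain k r where k: "k \<in> K" and r: "0 < r" "ball k r \<subseteq> K"
    using assms(1,2) by (meson ex_in_conv openE)
  obtain x0 where x0: "k = A *v x0 + b" using k assms(3) by auto
  have "\<exists>x. A *v x = y" for y
  proof -
    define s where "s = r / (norm y + 1)"
    have ny: "0 < norm y + 1" by (simp add: add_nonneg_pos)
    have s: "0 < s" using r ny by (simp add: s_def)
    have "norm (s *\<^sub>R y) = r * (norm y / (norm y + 1))" using r ny by (simp add: s_def)
    also have "\<dots> < r" using r ny by (simp add: divide_less_eq)
    finally have "k + s *\<^sub>R y \<in> K" using r(2) by (auto simp: dist_norm)
    then obtain x where "k + s *\<^sub>R y = A *v x + b" using assms(3) by auto
    then have "s *\<^sub>R y = A *v (x - x0)" using x0 by (simp add: matrix_vector_mult_diff_distrib algebra_simps)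
    then have "A *v ((1 / s) *\<^sub>R (x - x0)) = y"
      using s by (simp add: matrix_vector_mult_scaleR flip: \<open>s *\<^sub>R y = A *v (x - x0)\<close>)
    then show ?thesis by blast
  qed
  then have "surj ((*v) A)" by (metis surjI)
  then show ?thesis by (simp add: invertible_right_inverse matrix_right_invertible_surjective)
qed

lemma invertible_matrix_inv:
  fixes A :: "real^'n^'n"
  assumes "invertible A"
  shows "A *v (matrix_inv A *v x) = x" "matrix_inv A *v (A *v x) = x"
proof -
  have "A ** matrix_inv A = mat 1 \<and> matrix_inv A ** A = mat 1"
    using assms unfolding invertible_def matrix_inv_def by (rule someI_ex)
  then show "A *v (matrix_inv A *v x) = x" "matrix_inv A *v (A *v x) = x"
    by (simp_all add: matrix_vector_mul_assoc)
qed

locale simplicial_mesh =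
  fixes \<Omega> :: "(real^'n) set" and \<T> :: "(real^'n) set set" and A :: "(real^'n) set \<Rightarrow> real^'n^'n"
    and b :: "(real^'n) set \<Rightarrow> real^'n" and g :: real
  assumes mesh: "is_mesh \<Omega> \<T> A b" and shape: "shape_regular_mesh g \<T> A" and g_ge_1: "1 \<le> g"
begin

lemma g_pos: "0 < g"
  using g_ge_1 by simp

lemma partition: "is_partition \<Omega> \<T>" and finite_mesh: "finite \<T>"
  using mesh by (simp_all add: is_mesh_def)

lemma element: "K \<in> \<T> \<Longrightarrow> K = (\<lambda>x. A K *v x + b K) ` ref_simplex"
  using mesh by (simp add: is_mesh_def)

lemma open_element: "K \<in> \<T> \<Longrightarrow> open K" and bounded_element: "K \<in> \<T> \<Longrightarrow> bounded K"
  and closure_domain: "closure \<Omega> = (\<Union>K\<in>\<T>. closure K)"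
  using partition by (simp_all add: is_partition_def)

lemma elements_disjoint: "K \<in> \<T> \<Longrightarrow> K' \<in> \<T> \<Longrightarrow> K \<noteq> K' \<Longrightarrow> K \<inter> K' = {}"
  using partition by (auto simp: is_partition_def pairwise_def disjnt_def)

lemma element_nonempty: "K \<in> \<T> \<Longrightarrow> K \<noteq> {}"
  using element[of K] interior_std_simplex_nonempty by (auto simp: ref_simplex_def)

lemma convex_element: "K \<in> \<T> \<Longrightarrow> convex K"
proof -
  assume "K \<in> \<T>"
  have "K = (\<lambda>x. b K + x) ` ((*v) (A K) ` ref_simplex)"
    using element[OF \<open>K \<in> \<T>\<close>] by (simp add: image_image add.commute)
  moreover have "convex (ref_simplex :: (real^'n) set)" by (simp add: ref_simplex_def convex_interior)
  ultimately show ?thesis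
    by (metis convex_linear_image convex_translation matrix_vector_mul_linear)
qed

lemma invertible_A: "K \<in> \<T> \<Longrightarrow> invertible (A K)"
  by (rule affine_image_onto_open_imp_invertible[OF open_element element_nonempty element])

lemma diameter_pos: "K \<in> \<T> \<Longrightarrow> 0 < diameter K"
proof -
  assume K: "K \<in> \<T>"
  then obtain x where x: "x \<in> K" using element_nonempty by blast
  have "K \<noteq> {x}" using open_element[OF K] not_open_singleton by metis
  then obtain y where "y \<in> K" "y \<noteq> x" using x by blast
  then show ?thesis
    using diameter_bounded_bound[OF bounded_element[OF K] x, of y] by (smt (verit) zero_less_dist_iff)
qed

text \<open>The second summand of the shape regularity quantity is what prevents an element from being thin.\<close>

lemma norm_inv_le:
  assumes "K \<in> \<T>"
  shows "norm (matrix_inv (A K) *v x) \<le> g / diameter K * norm x"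
proof -
  let ?B = "matrix_inv (A K)"
  have "0 \<le> inverse (diameter K) * onorm ((*v) (A K))"
    using diameter_pos[OF assms] by (simp add: onorm_pos_le linear_linear)
  moreover have "inverse (diameter K) * onorm ((*v) (A K)) + diameter K * onorm ((*v) ?B) \<le> g"
    using shape assms by (simp add: shape_regular_mesh_def)
  ultimately have "diameter K * onorm ((*v) ?B) \<le> g" by linarith
  then have "onorm ((*v) ?B) \<le> g / diameter K"
    using diameter_pos[OF assms] by (simp add: field_simps)
  moreover have "norm (?B *v x) \<le> onorm ((*v) ?B) * norm x"
    by (rule onorm[OF matrix_vector_mul_bounded_linear])
  ultimately show ?thesis by (meson mult_right_mono norm_ge_zero order_trans)
qed

definition vertices :: "(real^'n) set \<Rightarrow> (real^'n) set" where
  "vertices K = (\<lambda>x. A K *v x + b K) ` insert 0 Basis"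

lemma closure_element: "K \<in> \<T> \<Longrightarrow> closure K = convex hull vertices K"
proof -
  assume K: "K \<in> \<T>"
  have "compact (convex hull (insert 0 Basis :: (real^'n) set))"
    by (intro finite_imp_compact_convex_hull) simp
  then have "closure (ref_simplex :: (real^'n) set) = convex hull (insert 0 Basis)"
    unfolding ref_simplex_def using interior_std_simplex_nonempty
    by (subst convex_closure_interior) (auto simp: closure_closed compact_imp_closed)
  then show ?thesis
    by (subst element[OF K]) (simp only: closure_affine_image[OF invertible_A[OF K]] vertices_def convex_hull_affine_image)
qed

lemma vertices_subset: "K \<in> \<T> \<Longrightarrow> vertices K \<subseteq> closure K"
  using closure_element hull_subset by metis

lemma finite_vertices: "finite (vertices K)" and card_vertices: "card (vertices K) \<le> Suc CARD('n)"
proof -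
  show "finite (vertices K)" by (simp add: vertices_def)
  have "card (vertices K) \<le> card (insert 0 Basis :: (real^'n) set)"
    unfolding vertices_def by (rule card_image_le) simp
  also have "\<dots> \<le> Suc CARD('n)" using card_insert_le_m1[of "Suc CARD('n)" "Basis :: (real^'n) set"] by simp
  finally show "card (vertices K) \<le> Suc CARD('n)" .
qed

text \<open>By Krein and Milman the common face is spanned by its extreme points. These are extreme points of both
  closed elements and therefore vertices of both.\<close>

lemma common_face:
  assumes "K \<in> \<T>" "K' \<in> \<T>"
  shows "\<exists>G. G \<subseteq> vertices K \<and> G \<subseteq> vertices K' \<and> closure K \<inter> closure K' = convex hull G"
proof (intro exI conjI)
  let ?F = "closure K \<inter> closure K'"
  let ?G = "{x. x extreme_point_of ?F}"
  have face: "?F face_of closure K" "?F face_of closure K'" using mesh assms by (auto simp: is_mesh_def)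
  show "?G \<subseteq> vertices K" "?G \<subseteq> vertices K'"
    using extreme_point_of_face[OF face(1)] extreme_point_of_face[OF face(2)] extreme_point_of_convex_hull
    unfolding closure_element[OF assms(1), symmetric] closure_element[OF assms(2), symmetric]
    by (auto simp: closure_element[OF assms(1)] closure_element[OF assms(2)])
  show "?F = convex hull ?G"
    using assms bounded_element convex_element
    by (intro Krein_Milman_Minkowski) (auto intro!: compact_Int convex_Int convex_closure simp: compact_closure)
qed

text \<open>The affine function that is \<open>1\<close> at the vertices of \<open>K\<close> lying in \<open>W\<close> and \<open>0\<close> at the other
  vertices of \<open>K\<close>, written in the coordinates of the reference simplex.\<close>

definition nodal :: "(real^'n) set \<Rightarrow> (real^'n) set \<Rightarrow> real^'n \<Rightarrow> real" where
  "nodal W K x = indicator W (b K) +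
     (\<Sum>i\<in>UNIV. (indicator W (A K *v axis i 1 + b K) - indicator W (b K)) * (matrix_inv (A K) *v (x - b K)) $ i)"

lemma nodal_vertex:
  assumes "K \<in> \<T>" "v \<in> vertices K"
  shows "nodal W K v = indicator W v"
proof -
  consider "v = b K" | j where "v = A K *v axis j 1 + b K"
    using assms(2) by (auto simp: vertices_def Basis_vec_def)
  then show ?thesis
  proof cases
    case 1
    then show ?thesis by (simp add: nodal_def)
  next
    case 2
    then have "matrix_inv (A K) *v (v - b K) = axis j 1"
      by (simp add: invertible_matrix_inv[OF invertible_A[OF assms(1)]])
    moreover have "(\<Sum>i\<in>UNIV. c i * axis j 1 $ i) = c j" for c :: "'n \<Rightarrow> real"
      by (simp add: axis_def if_distrib cong: if_cong)
    ultimately show ?thesis using 2 by (simp add: nodal_def)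
  qed
qed

lemma nodal_lipschitz:
  assumes "K \<in> \<T>"
  shows "\<bar>nodal W K x - nodal W K y\<bar> \<le> CARD('n) * g / diameter K * dist x y"
proof -
  let ?B = "matrix_inv (A K)"
  let ?c = "\<lambda>i. indicator W (A K *v axis i 1 + b K) - indicator W (b K) :: real"
  have "nodal W K x - nodal W K y = (\<Sum>i\<in>UNIV. ?c i * (?B *v (x - y)) $ i)"
    by (simp add: nodal_def matrix_vector_mult_diff_distrib algebra_simps flip: sum_subtractf)
  also have "\<bar>\<dots>\<bar> \<le> (\<Sum>i\<in>(UNIV::'n set). g / diameter K * dist x y)"
  proof (intro order_trans[OF sum_abs] sum_mono)
    fix i
    have "\<bar>?c i\<bar> \<le> 1" by (auto simp: indicator_def)
    then have "\<bar>?c i * (?B *v (x - y)) $ i\<bar> \<le> 1 * norm (?B *v (x - y))"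
      unfolding abs_mult by (intro mult_mono component_le_norm_cart) auto
    also have "\<dots> \<le> g / diameter K * dist x y"
      using norm_inv_le[OF assms, of "x - y"] by (simp add: dist_norm)
    finally show "\<bar>?c i * (?B *v (x - y)) $ i\<bar> \<le> g / diameter K * dist x y" .
  qed
  finally show ?thesis by (simp add: mult_ac)
qed

lemma nodal_affine:
  assumes "u + v = 1"
  shows "nodal W K (u *\<^sub>R x + v *\<^sub>R y) = u * nodal W K x + v * nodal W K y"
proof -
  let ?B = "matrix_inv (A K)"
  have "u *\<^sub>R x + v *\<^sub>R y - b K = u *\<^sub>R (x - b K) + v *\<^sub>R (y - b K)"
    using assms by (simp add: algebra_simps flip: scaleR_left.add)
  then have "?B *v (u *\<^sub>R x + v *\<^sub>R y - b K) = u *\<^sub>R (?B *v (x - b K)) + v *\<^sub>R (?B *v (y - b K))"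
    by (simp only: matrix_vector_right_distrib matrix_vector_mult_scaleR)
  then have comp: "(?B *v (u *\<^sub>R x + v *\<^sub>R y - b K)) $ i = u * (?B *v (x - b K)) $ i + v * (?B *v (y - b K)) $ i" for i
    by simp
  have lin: "(\<Sum>i\<in>UNIV. c i * (u * X i + v * Y i)) = u * (\<Sum>i\<in>UNIV. c i * X i) + v * (\<Sum>i\<in>UNIV. c i * Y i)"
    for c X Y :: "'n \<Rightarrow> real"
    by (simp add: sum_distrib_left sum.distrib algebra_simps)
  have "i0 = u * i0 + v * i0" for i0 :: real using assms by (metis distrib_right mult_1)
  from this[of "indicator W (b K)"] show ?thesis
    unfolding nodal_def comp lin by (simp add: algebra_simps)
qed

text \<open>Two affine functions that agree at the vertices of the common face agree on the common face. This is
  the point at which the absence of hanging nodes enters.\<close>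

lemma nodal_consistent:
  assumes K: "K \<in> \<T>" "K' \<in> \<T>" and x: "x \<in> closure K" "x \<in> closure K'"
  shows "nodal W K x = nodal W K' x"
proof -
  obtain G where G: "G \<subseteq> vertices K" "G \<subseteq> vertices K'" "closure K \<inter> closure K' = convex hull G"
    using common_face[OF K] by blast
  have "convex {x. nodal W K x = nodal W K' x}"
    by (auto simp: convex_def nodal_affine)
  moreover have "G \<subseteq> {x. nodal W K x = nodal W K' x}"
    using G K by (auto simp: nodal_vertex subset_iff)
  ultimately have "convex hull G \<subseteq> {x. nodal W K x = nodal W K' x}" by (simp add: hull_minimal)
  with G x show ?thesis by blast
qed

text \<open>The nodal function of a single vertex \<open>p\<close> drops from \<open>1\<close> at \<open>p\<close> to \<open>0\<close> at \<open>q\<close>.\<close>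

lemma vertex_dist:
  assumes "K \<in> \<T>" "p \<in> vertices K" "q \<in> vertices K" "p \<noteq> q"
  shows "diameter K \<le> CARD('n) * g * dist p q"
proof -
  have "1 \<le> CARD('n) * g / diameter K * dist p q"
    using nodal_lipschitz[OF assms(1), of "{p}" p q] assms by (simp add: nodal_vertex)
  then show ?thesis using diameter_pos[OF assms(1)] by (simp add: field_simps)
qed

text \<open>A common face with two points has two vertices, so the elements share an edge. Its length is at most
  the diameter of \<open>K'\<close> and not much smaller than that of \<open>K\<close>.\<close>

lemma diameter_le_if_common_points:
  assumes K: "K \<in> \<T>" "K' \<in> \<T>" and v: "v \<in> closure K \<inter> closure K'" and w: "w \<in> closure K \<inter> closure K'" and "v \<noteq> w"
  shows "diameter K \<le> CARD('n) * g * diameter K'"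
proof -
  obtain G where G: "G \<subseteq> vertices K" "closure K \<inter> closure K' = convex hull G"
    using common_face[OF K] by blast
  have "\<not> G \<subseteq> {p}" for p
  proof
    assume "G \<subseteq> {p}"
    then have "convex hull G \<subseteq> {p}" by (simp add: hull_minimal)
    with G v w \<open>v \<noteq> w\<close> show False by blast
  qed
  then obtain p q where pq: "p \<in> G" "q \<in> G" "p \<noteq> q" by blast
  have "p \<in> closure K'" "q \<in> closure K'" using pq G(2) hull_subset[of G] by blast+
  then have "dist p q \<le> diameter K'"
    using diameter_bounded_bound[of "closure K'" p q] bounded_element[OF K(2)]
    by (simp add: diameter_closure bounded_closure)
  moreover have "diameter K \<le> CARD('n) * g * dist p q"
    using pq G by (intro vertex_dist K) auto
  ultimately show ?thesis
    using g_pos by (meson mult_left_mono mult_nonneg_nonneg less_imp_le of_nat_0_le_iff order_trans)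
qed

text \<open>Shrinking an element \<open>K\<close> with \<open>v \<in> closure K\<close> towards \<open>v\<close> by the factor \<open>t / diameter K\<close> keeps it
  inside \<open>K\<close> by convexity. The images of the centres of the reference ball lie within distance \<open>t\<close> of
  \<open>v\<close>, and each is the centre of a ball of radius \<open>\<rho> / g * t\<close> contained in its element. Elements are
  disjoint, so the centres are separated, however different the elements are in size.\<close>

lemma card_elements_at_point:
  assumes ref: "ball x0 \<rho> \<subseteq> (ref_simplex :: (real^'n) set)" "0 < \<rho>"
    and packing: "\<And>t (v::real^'n) Z. 0 < t \<Longrightarrow> Z \<subseteq> cball v t \<Longrightarrow> separated (\<rho> / g * t) Z \<Longrightarrow> card Z \<le> N"
  shows "card {K\<in>\<T>. v \<in> closure K} \<le> N"
proof -
  let ?T = "{K\<in>\<T>. v \<in> closure K}"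
  define t where "t = Min (insert 1 (diameter ` ?T))"
  have t: "0 < t" unfolding t_def using finite_mesh diameter_pos by (subst Min_gr_iff) auto
  have t_le: "t \<le> diameter K" if "K \<in> ?T" for K
    unfolding t_def using finite_mesh that by (intro Min_le) auto
  define c where "c K = A K *v x0 + b K" for K
  define m where "m K = v - (t / diameter K) *\<^sub>R (v - c K)" for K
  have x0: "x0 \<in> ref_simplex" using ref by (meson centre_in_ball subsetD)
  have cK: "c K \<in> K" if "K \<in> \<T>" for K
    by (subst element[OF that]) (use x0 in \<open>auto simp: c_def\<close>)
  have c_ball: "w \<in> K" if K: "K \<in> \<T>" and w: "dist w (c K) < \<rho> / g * diameter K" for K w
  proof -
    let ?y = "matrix_inv (A K) *v (w - b K)"
    have "?y - x0 = matrix_inv (A K) *v (w - c K)"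
      using invertible_matrix_inv(2)[OF invertible_A[OF K], of x0]
      by (simp add: c_def matrix_vector_mult_diff_distrib matrix_vector_right_distrib algebra_simps)
    then have "norm (?y - x0) \<le> g / diameter K * dist w (c K)"
      using norm_inv_le[OF K, of "w - c K"] by (simp add: dist_norm)
    also have "\<dots> < g / diameter K * (\<rho> / g * diameter K)"
      using w g_pos diameter_pos[OF K] by (intro mult_strict_left_mono) auto
    also have "\<dots> = \<rho>" using g_pos diameter_pos[OF K] by simp
    finally have "?y \<in> ref_simplex" using ref by (auto simp: dist_norm norm_minus_commute)
    moreover have "w = A K *v ?y + b K"
      by (simp add: invertible_matrix_inv[OF invertible_A[OF K]])
    ultimately show ?thesis by (subst element[OF K]) blast
  qed
  have m_ball: "y \<in> K" if K: "K \<in> ?T" and y: "dist y (m K) < \<rho> / g * t" for K y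
  proof -
    let ?s = "t / diameter K"
    have KT: "K \<in> \<T>" and vK: "v \<in> closure K" using K by auto
    have s: "0 < ?s" "?s \<le> 1" using t t_le[OF K] diameter_pos[OF KT] by (auto simp: divide_le_eq)
    define w where "w = v + (1 / ?s) *\<^sub>R (y - v)"
    have yw: "y = v - ?s *\<^sub>R (v - w)" using s t diameter_pos[OF KT] by (simp add: w_def)
    have "y - m K = ?s *\<^sub>R (w - c K)" by (simp add: yw m_def algebra_simps)
    then have "dist y (m K) = ?s * dist w (c K)"
      unfolding dist_norm by (simp only: norm_scaleR abs_of_pos[OF s(1)])
    moreover have "\<rho> / g * t = ?s * (\<rho> / g * diameter K)" using diameter_pos[OF KT] by simp
    ultimately have "dist w (c K) < \<rho> / g * diameter K"
      using y s(1) mult_less_cancel_left_pos by metis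
    then have "w \<in> interior K" using c_ball[OF KT] open_element[OF KT] by (simp add: interior_open)
    then show ?thesis
      using mem_interior_closure_convex_shrink[OF convex_element[OF KT] _ vK s] interior_subset yw by blast
  qed
  have far: "\<rho> / g * t \<le> dist (m K) (m K')" if "K \<in> ?T" "K' \<in> ?T" "K \<noteq> K'" for K K'
  proof (rule ccontr)
    assume "\<not> \<rho> / g * t \<le> dist (m K) (m K')"
    then have "m K \<in> K'" using m_ball[OF that(2)] by simp
    moreover have "m K \<in> K" using m_ball[OF that(1), of "m K"] t g_pos ref by simp
    ultimately show False using elements_disjoint that by blast
  qed
  have pos: "0 < \<rho> / g * t" using t g_pos ref by simp
  have inj: "inj_on m ?T"
  proof (rule inj_onI, rule ccontr)
    fix K K' assume "K \<in> ?T" "K' \<in> ?T" "m K = m K'" "K \<noteq> K'"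
    then show False using far[of K K'] pos by simp
  qed
  have sep: "separated (\<rho> / g * t) (m ` ?T)" using far by (auto simp: separated_def)
  have sub: "m ` ?T \<subseteq> cball v t"
  proof
    fix p assume "p \<in> m ` ?T"
    then obtain K where K: "K \<in> ?T" "p = m K" by blast
    have KT: "K \<in> \<T>" using K by auto
    have "dist v (c K) \<le> diameter K"
      using diameter_bounded_bound[of "closure K" v "c K"] bounded_element[OF KT] K cK[OF KT] closure_subset[of K]
      by (auto simp: diameter_closure)
    then have "t / diameter K * dist v (c K) \<le> t / diameter K * diameter K"
      using t diameter_pos[OF KT] by (intro mult_left_mono) auto
    moreover have "dist v (m K) = t / diameter K * dist v (c K)"
      using t diameter_pos[OF KT] by (simp add: m_def dist_norm)
    ultimately show "p \<in> cball v t" using diameter_pos[OF KT] by (simp add: K(2))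
  qed
  show ?thesis using packing[OF t sub sep] card_image[OF inj] by simp
qed

end

section \<open>Touching elements\<close>

context simplicial_mesh
begin

text \<open>If \<open>v \<in> \<Omega>\<close>, a punctured ball is connected in dimension at least two. Otherwise \<open>v\<close> is a boundary
  point, and a short path in \<open>\<Omega>\<close> avoids it automatically.\<close>

lemma punctured_neighbourhood_connected:
  assumes dom: "open \<Omega>" "2 \<le> CARD('n)"
    and path: "0 < \<delta>" "1 \<le> C" "\<And>x y. x \<in> \<Omega> \<Longrightarrow> y \<in> \<Omega> \<Longrightarrow> dist x y < \<delta> \<Longrightarrow> joined_within \<Omega> C x y"
    and K: "K \<in> \<T>" "v \<in> closure K" and K': "K' \<in> \<T>" "v \<in> closure K'" and r: "0 < r"
  shows "\<exists>S. connected S \<and> S \<subseteq> \<Omega> \<inter> ball v r - {v} \<and> S \<inter> K \<noteq> {} \<and> S \<inter> K' \<noteq> {}"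
proof (cases "v \<in> \<Omega>")
  case True
  then obtain s0 where "0 < s0" "ball v s0 \<subseteq> \<Omega>" using dom(1) by (meson openE)
  then have s: "0 < min s0 r" "ball v (min s0 r) \<subseteq> \<Omega> \<inter> ball v r" using r by auto
  have "(ball v (min s0 r) - {v}) \<inter> L \<noteq> {}" if "L \<in> \<T>" "v \<in> closure L" for L
  proof -
    have "L \<inter> ball v (min s0 r) \<noteq> {}"
      using partition_element_meets_domain[OF partition that s(1)] by blast
    moreover have "open (L \<inter> ball v (min s0 r))" using open_element[OF that(1)] by (intro open_Int open_ball)
    ultimately have "\<not> L \<inter> ball v (min s0 r) \<subseteq> {v}"
      using not_open_singleton[of v] by (metis subset_singletonD)
    then show ?thesis by blast
  qed
  moreover have "connected (ball v (min s0 r) - {v})"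
    using dom(2) by (intro connected_punctured_ball) simp
  ultimately show ?thesis
    using s(2) K K' by (intro exI[of _ "ball v (min s0 r) - {v}"]) auto
next
  case False
  define s where "s = min (\<delta> / 2) (r / (1 + 4 * C))"
  have s: "0 < s" using path r by (simp add: s_def)
  obtain x y where x: "x \<in> K" "x \<in> \<Omega>" "dist v x < s" and y: "y \<in> K'" "y \<in> \<Omega>" "dist v y < s"
    using partition_element_meets_domain[OF partition K s] partition_element_meets_domain[OF partition K' s]
    by auto
  have xy: "dist x y < 2 * s" using x y dist_triangle[of x y v] by (simp add: dist_commute)
  have "2 * s \<le> \<delta>" by (simp add: s_def)
  then have "joined_within \<Omega> C x y" using path x y xy by auto
  then obtain S where S: "connected S" "x \<in> S" "y \<in> S" "S \<subseteq> \<Omega>" "S \<subseteq> cball x (2 * C * dist x y)"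
    using joined_within_connected_set path(2) by blast
  have "S \<subseteq> ball v r"
  proof
    fix p assume "p \<in> S"
    then have "dist x p \<le> 2 * C * dist x y" using S by auto
    also have "\<dots> \<le> 2 * C * (2 * s)" using xy path(2) by (intro mult_left_mono) auto
    finally have "dist v p < s + 4 * C * s" using x dist_triangle[of v p x] by simp
    also have "\<dots> = s * (1 + 4 * C)" by (simp add: algebra_simps)
    also have "\<dots> \<le> r / (1 + 4 * C) * (1 + 4 * C)"
      using path(2) by (intro mult_right_mono) (auto simp: s_def)
    also have "\<dots> = r" using path(2) by simp
    finally show "p \<in> ball v r" by simp
  qed
  then show ?thesis using S x y False by (intro exI[of _ S]) auto
qed

text \<open>Link two elements at \<open>v\<close> if their closures share a point other than \<open>v\<close>; linked elements have
  comparable diameters. If \<open>K'\<close> were not reachable from \<open>K\<close>, the closures of the reachable elements and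
  those of the others would disconnect the set of the previous lemma. As at most \<open>N\<close> elements
  contain \<open>v\<close> in their closure, a chain of at most \<open>N * N\<close> links suffices.\<close>

lemma diameter_comparable_at_point:
  assumes dom: "open \<Omega>" "2 \<le> CARD('n)"
    and path: "0 < \<delta>" "1 \<le> C" "\<And>x y. x \<in> \<Omega> \<Longrightarrow> y \<in> \<Omega> \<Longrightarrow> dist x y < \<delta> \<Longrightarrow> joined_within \<Omega> C x y"
    and N: "card {K\<in>\<T>. v \<in> closure K} \<le> N"
    and K: "K \<in> \<T>" "v \<in> closure K" and K': "K' \<in> \<T>" "v \<in> closure K'"
  shows "diameter K \<le> (CARD('n) * g) ^ (N * N) * diameter K'"
proof -
  let ?T = "{K\<in>\<T>. v \<in> closure K}"
  define \<kappa> where "\<kappa> = CARD('n) * g"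
  have "1 * 1 \<le> real CARD('n) * g" using g_ge_1 dom(2) by (intro mult_mono) auto
  then have \<kappa>: "1 \<le> \<kappa>" by (simp add: \<kappa>_def)
  define R where "R = {(K1, K2). K1 \<in> ?T \<and> K2 \<in> ?T \<and> (\<exists>w. w \<noteq> v \<and> w \<in> closure K1 \<inter> closure K2)}"
  have step: "diameter K1 \<le> \<kappa> * diameter K2" if K12: "(K1, K2) \<in> R" for K1 K2
  proof -
    obtain w where "K1 \<in> \<T>" "K2 \<in> \<T>" "v \<in> closure K1 \<inter> closure K2" "w \<in> closure K1 \<inter> closure K2" "v \<noteq> w"
      using K12 unfolding R_def by blast
    then show ?thesis unfolding \<kappa>_def by (rule diameter_le_if_common_points)
  qed
  have chain: "(K, L) \<in> R ^^ n \<Longrightarrow> diameter K \<le> \<kappa> ^ n * diameter L" for n L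
  proof (induction n arbitrary: L)
    case (Suc n)
    then obtain M where M: "(K, M) \<in> R ^^ n" "(M, L) \<in> R" by (auto elim: relpow_Suc_E)
    have "\<kappa> ^ n * diameter M \<le> \<kappa> ^ n * (\<kappa> * diameter L)"
      using step[OF M(2)] \<kappa> by (intro mult_left_mono) auto
    with Suc.IH[OF M(1)] show ?case by (simp add: mult_ac)
  qed simp
  \<comment> \<open>Close to the point, only the elements that touch it are present.\<close>
  have "closed (\<Union>L\<in>\<T> - ?T. closure L)" using finite_mesh by (intro closed_UN) auto
  then have "open (- (\<Union>L\<in>\<T> - ?T. closure L))" by (rule open_Compl)
  moreover have "v \<in> - (\<Union>L\<in>\<T> - ?T. closure L)" by auto
  ultimately obtain r where r: "0 < r" "ball v r \<subseteq> - (\<Union>L\<in>\<T> - ?T. closure L)"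
    by (meson openE)
  obtain S where S: "connected S" "S \<subseteq> \<Omega> \<inter> ball v r - {v}" "S \<inter> K \<noteq> {}" "S \<inter> K' \<noteq> {}"
    using punctured_neighbourhood_connected[OF dom path K K' r(1)] by blast
  have cover: "S \<subseteq> (\<Union>L\<in>?T. closure L)"
  proof
    fix p assume "p \<in> S"
    then have p: "p \<in> closure \<Omega>" "p \<in> ball v r" using S(2) closure_subset[of \<Omega>] by auto
    then obtain L where "L \<in> \<T>" "p \<in> closure L" unfolding closure_domain by blast
    with p(2) r(2) show "p \<in> (\<Union>L\<in>?T. closure L)" by blast
  qed
  have "(K, K') \<in> R\<^sup>*"
  proof (rule ccontr)
    assume no: "(K, K') \<notin> R\<^sup>*"
    define P where "P = {L \<in> ?T. (K, L) \<in> R\<^sup>*}"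
    let ?A = "\<Union>L\<in>P. closure L" and ?B = "\<Union>L\<in>?T - P. closure L"
    have "closed ?A" "closed ?B" using finite_mesh by (auto intro!: closed_UN simp: P_def)
    moreover have "S \<subseteq> ?A \<union> ?B" using cover by blast
    moreover have "?A \<inter> ?B \<inter> S = {}"
    proof (rule ccontr)
      assume "?A \<inter> ?B \<inter> S \<noteq> {}"
      then obtain w K1 K2 where w: "w \<in> S" "w \<in> closure K1" "w \<in> closure K2" "K1 \<in> P" "K2 \<in> ?T - P"
        by blast
      then have "(K1, K2) \<in> R" using S(2) unfolding R_def P_def by blast
      moreover have "(K, K1) \<in> R\<^sup>*" using w(4) unfolding P_def by blast
      ultimately have "(K, K2) \<in> R\<^sup>*" by (rule rtrancl_into_rtrancl[rotated])
      then show False using w(5) unfolding P_def by blast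
    qed
    moreover have "?A \<inter> S \<noteq> {}"
    proof -
      have "K \<in> P" using K by (simp add: P_def)
      then show ?thesis using S(3) closure_subset[of K] by blast
    qed
    moreover have "?B \<inter> S \<noteq> {}"
    proof -
      have "K' \<in> ?T - P" using K' no by (simp add: P_def)
      then show ?thesis using S(4) closure_subset[of K'] by blast
    qed
    ultimately show False using connected_closedD[OF S(1), of ?A ?B] by satx
  qed
  moreover have R: "R \<subseteq> ?T \<times> ?T" unfolding R_def by blast
  have finR: "finite R" using finite_mesh by (intro finite_subset[OF R]) simp
  ultimately obtain n where n: "n \<le> card R" "(K, K') \<in> R ^^ n"
    unfolding rtrancl_finite_eq_relpow[OF finR] by blast
  have "card R \<le> card (?T \<times> ?T)" using R finite_mesh by (intro card_mono) auto
  also have "\<dots> \<le> N * N" unfolding card_cartesian_product using N by (intro mult_mono) auto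
  finally have "\<kappa> ^ n \<le> \<kappa> ^ (N * N)" using n(1) \<kappa> by (intro power_increasing) auto
  then have "\<kappa> ^ n * diameter K' \<le> \<kappa> ^ (N * N) * diameter K'"
    using diameter_pos[OF K'(1)] by (intro mult_right_mono) auto
  with chain[OF n(2)] show ?thesis by (simp add: \<kappa>_def)
qed

text \<open>Touching elements share a vertex.\<close>

lemma card_neighbours:
  assumes N: "\<And>v. card {K\<in>\<T>. v \<in> closure K} \<le> N" and K: "K \<in> \<T>"
  shows "card {K'\<in>\<T>. closure K' \<inter> closure K \<noteq> {}} \<le> Suc CARD('n) * N"
proof -
  have "{K'\<in>\<T>. closure K' \<inter> closure K \<noteq> {}} \<subseteq> (\<Union>v\<in>vertices K. {K'\<in>\<T>. v \<in> closure K'})"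
  proof
    fix K' assume K': "K' \<in> {K'\<in>\<T>. closure K' \<inter> closure K \<noteq> {}}"
    then obtain G where G: "G \<subseteq> vertices K" "closure K \<inter> closure K' = convex hull G"
      using common_face[OF K] by blast
    then obtain v where "v \<in> G" using K' by (auto simp: Int_commute)
    then have "v \<in> vertices K" "v \<in> closure K'" using G hull_subset[of G] by blast+
    then show "K' \<in> (\<Union>v\<in>vertices K. {K'\<in>\<T>. v \<in> closure K'})" using K' by blast
  qed
  then have "card {K'\<in>\<T>. closure K' \<inter> closure K \<noteq> {}} \<le> card (\<Union>v\<in>vertices K. {K'\<in>\<T>. v \<in> closure K'})"
    using finite_mesh finite_vertices by (intro card_mono) auto
  also have "\<dots> \<le> (\<Sum>v\<in>vertices K. card {K'\<in>\<T>. v \<in> closure K'})"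
    by (rule card_UN_le[OF finite_vertices])
  also have "\<dots> \<le> card (vertices K) * N"
    using N by (metis (no_types, lifting) of_nat_id sum_bounded_above)
  also have "\<dots> \<le> Suc CARD('n) * N" by (rule mult_right_mono[OF card_vertices]) simp
  finally show ?thesis .
qed

text \<open>The function \<open>u\<close> glues the nodal functions of the vertices in \<open>closure K\<close>. It is constant \<open>1\<close> on
  \<open>K\<close>, constant \<open>0\<close> on elements that do not touch \<open>K\<close>, and on the neighbours of \<open>K\<close> its slope is at
  most a constant over \<open>diameter K\<close>. Hence \<open>u\<close> cannot drop from \<open>1\<close> to \<open>0\<close> along the three segments
  that join two close points of \<open>\<Omega>\<close>.\<close>

lemma close_points_in_patch:
  assumes path: "0 < \<delta>" "1 \<le> C" "\<And>x y. x \<in> \<Omega> \<Longrightarrow> y \<in> \<Omega> \<Longrightarrow> dist x y < \<delta> \<Longrightarrow> joined_within \<Omega> C x y"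
    and size: "0 < \<sigma>" "\<And>K K'. K \<in> \<T> \<Longrightarrow> K' \<in> \<T> \<Longrightarrow> closure K \<inter> closure K' \<noteq> {} \<Longrightarrow> diameter K \<le> \<sigma> * diameter K'"
    and K: "K \<in> \<T>" "x \<in> K" and y: "y \<in> \<Omega>"
    and close: "dist x y < \<delta>" "dist x y < diameter K / (3 * C * CARD('n) * g * \<sigma>)"
  shows "\<exists>K'\<in>\<T>. closure K' \<inter> closure K \<noteq> {} \<and> y \<in> closure K'"
proof (rule ccontr)
  assume "\<not> ?thesis"
  then have no: "K' \<in> \<T> \<Longrightarrow> y \<in> closure K' \<Longrightarrow> closure K' \<inter> closure K = {}" for K' by blast
  define Q where "Q = diameter K / (3 * C * CARD('n) * g * \<sigma>)"
  \<comment> \<open>The point is moved into the domain, where short paths are available, without violating the strict bounds on the distance.\<close>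
  define s where "s = min \<delta> Q - dist x y"
  have s: "0 < s" using close by (simp add: s_def Q_def)
  have "x \<in> closure K" using K closure_subset by blast
  from partition_element_meets_domain[OF partition K(1) this s]
  obtain x' where x': "x' \<in> K" "x' \<in> \<Omega>" "dist x x' < s" by auto
  have close': "dist x' y < \<delta>" "dist x' y < Q"
    using x'(3) dist_triangle[of x' y x] by (auto simp: s_def dist_commute[of x'])
  define u where "u p = nodal (closure K) (SOME L. L \<in> \<T> \<and> p \<in> closure L) p" for p
  have u: "u p = nodal (closure K) L p" if "L \<in> \<T>" "p \<in> closure L" for L p
    unfolding u_def using someI[of "\<lambda>L. L \<in> \<T> \<and> p \<in> closure L" L] that
    by (intro nodal_consistent) auto
  define \<Lambda> where "\<Lambda> = CARD('n) * g * \<sigma> / diameter K"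
  have h: "0 < diameter K" using diameter_pos[OF K(1)] .
  have \<Lambda>: "0 \<le> \<Lambda>" using g_pos size(1) h by (simp add: \<Lambda>_def)
  have in_vertices: "b L \<in> closure L" "A L *v axis i 1 + b L \<in> closure L" if "L \<in> \<T>" for L i
    using vertices_subset[OF that] by (auto simp: vertices_def Basis_vec_def)
  have far0: "nodal (closure K) L p = 0" if "L \<in> \<T>" "closure L \<inter> closure K = {}" for L p
    using in_vertices[OF that(1)] that(2) by (auto simp: nodal_def indicator_def disjoint_iff)
  have near1: "nodal (closure K) K p = 1" for p
    using in_vertices[OF K(1)] by (simp add: nodal_def)
  have lip: "\<bar>nodal (closure K) L p - nodal (closure K) L q\<bar> \<le> \<Lambda> * dist p q" if L: "L \<in> \<T>" for L p q
  proof (cases "closure L \<inter> closure K = {}")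
    case True
    then show ?thesis using far0[OF L] \<Lambda> by simp
  next
    case False
    have hL: "0 < diameter L" using diameter_pos[OF L] .
    have "diameter K \<le> \<sigma> * diameter L" using size(2)[OF K(1) L] False by (simp add: Int_commute)
    then have "1 / diameter L \<le> \<sigma> / diameter K" using h hL by (simp add: field_simps)
    then have "CARD('n) * g * (1 / diameter L) * dist p q \<le> CARD('n) * g * (\<sigma> / diameter K) * dist p q"
      using g_pos by (intro mult_right_mono mult_left_mono) auto
    then show ?thesis using nodal_lipschitz[OF L, of "closure K" p q] by (simp add: \<Lambda>_def)
  qed
  have seg: "\<bar>u p - u q\<bar> \<le> \<Lambda> * dist p q" if pq: "closed_segment p q \<subseteq> \<Omega>" for p q
  proof -
    let ?c = "\<lambda>t. (1 - t) *\<^sub>R p + t *\<^sub>R q"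
    have "(\<Lambda> * dist p q)-lipschitz_on {0..1} (\<lambda>t. u (?c t))"
    proof (rule lipschitz_on_closed_Union[where I = \<T> and U = "\<lambda>L. ?c -` closure L"])
      fix L assume L: "L \<in> \<T>"
      show "closed (?c -` closure L)"
        by (intro closed_vimage closed_closure continuous_intros)
      show "(\<Lambda> * dist p q)-lipschitz_on (?c -` closure L) (\<lambda>t. u (?c t))"
      proof (rule lipschitz_onI)
        fix s t assume st: "s \<in> ?c -` closure L" "t \<in> ?c -` closure L"
        have "?c s - ?c t = (t - s) *\<^sub>R (p - q)" by (simp add: algebra_simps)
        then have "dist (?c s) (?c t) = dist p q * dist s t"
          by (simp add: dist_norm abs_minus_commute mult.commute)
        then show "dist (u (?c s)) (u (?c t)) \<le> \<Lambda> * dist p q * dist s t"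
          using lip[OF L, of "?c s" "?c t"] u[OF L] st by (simp add: dist_real_def mult.assoc)
      qed (use \<Lambda> in simp)
    next
      show "{0..1} \<subseteq> (\<Union>L\<in>\<T>. ?c -` closure L)"
      proof
        fix t :: real assume "t \<in> {0..1}"
        then have "?c t \<in> closed_segment p q" by (auto simp: in_segment)
        then show "t \<in> (\<Union>L\<in>\<T>. ?c -` closure L)"
          using pq closure_domain closure_subset[of \<Omega>] by blast
      qed
    qed (use finite_mesh \<Lambda> in auto)
    from lipschitz_onD[OF this, of 0 1] show ?thesis by (simp add: dist_real_def)
  qed
  obtain a c where ac: "closed_segment x' a \<union> closed_segment a c \<union> closed_segment c y \<subseteq> \<Omega>"
    "dist x' a \<le> C * dist x' y" "dist a c \<le> C * dist x' y" "dist c y \<le> C * dist x' y"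
    using path(3)[OF x'(2) y close'(1)] unfolding joined_within_def by blast
  have "u x' = 1" using u[OF K(1), of x'] near1 x'(1) closure_subset[of K] by auto
  moreover have "u y = 0"
  proof -
    obtain L where L: "L \<in> \<T>" "y \<in> closure L" using y closure_domain closure_subset[of \<Omega>] by blast
    then show ?thesis using u[OF L] far0 no by simp
  qed
  moreover have "\<bar>u x' - u y\<bar> \<le> \<Lambda> * dist x' a + \<Lambda> * dist a c + \<Lambda> * dist c y"
    using seg[of x' a] seg[of a c] seg[of c y] ac(1) by auto
  ultimately have "1 \<le> \<Lambda> * (dist x' a + dist a c + dist c y)" by (simp add: algebra_simps)
  also have "\<dots> \<le> \<Lambda> * (3 * C * dist x' y)" using ac \<Lambda> by (intro mult_left_mono) auto
  also have "\<dots> < \<Lambda> * (3 * C * Q)"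
  proof -
    have "0 < \<Lambda>" using g_pos size(1) h by (simp add: \<Lambda>_def)
    then show ?thesis using close' path(2) by (intro mult_strict_left_mono) auto
  qed
  also have "\<dots> = 1" using g_pos size(1) h path(2) by (simp add: \<Lambda>_def Q_def)
  finally show False by simp
qed

end

section \<open>Existence of length scales\<close>

text \<open>An element meets \<open>\<Omega>\<close> in a nonempty open set, so its size is at most the \<open>L\<^sup>\<infinity>\<close> norm, and the
  smoothing result applies.\<close>

lemma piecewise_constant_length_scale:
  fixes \<Omega> :: "(real^'n) set"
  assumes \<Omega>: "open \<Omega>" and Creg: "0 < Creg"
  shows "\<exists>(C::real) L (\<Lambda> :: ('n \<Rightarrow> nat) \<Rightarrow> real). 0 < C \<and>
         (\<forall>(\<T> :: (real^'n) set set) (\<epsilon>t :: real^'n \<Rightarrow> real) (e :: (real^'n) set \<Rightarrow> real).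
            is_partition \<Omega> \<T> \<and>
            in_Linf \<Omega> \<epsilon>t \<and> Linf_norm \<Omega> \<epsilon>t = ereal N \<and>
            (\<forall>K\<in>\<T>. 0 < e K \<and> (\<forall>x\<in>K. \<epsilon>t x = e K)) \<and>
            (\<forall>K\<in>\<T>. finite {K'\<in>\<T>. nbhd K (Creg * e K) \<inter> nbhd K' (Creg * e K') \<noteq> {}} \<and>
                    card {K'\<in>\<T>. nbhd K (Creg * e K) \<inter> nbhd K' (Creg * e K') \<noteq> {}} \<le> M) \<and>
            (\<forall>K\<in>\<T>. \<forall>K'\<in>\<T>. nbhd K (Creg * e K) \<inter> nbhd K' (Creg * e K') \<noteq> {} \<longrightarrow>
                    0 < e K \<and> e K \<le> C\<epsilon> * e K')
            \<longrightarrow> (\<exists>\<epsilon>. admissible_length_scale \<Omega> (L, \<Lambda>) \<epsilon> \<and>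
                     (\<forall>K\<in>\<T>. comparable_on C K \<epsilon> (e K))))"
proof -
  obtain C L \<Lambda> where C: "0 < C" and main: "\<And>\<T> e. locally_comparable_sizes \<Omega> Creg C\<epsilon> N M \<T> e \<Longrightarrow>
     \<exists>\<epsilon>. admissible_length_scale \<Omega> (L, \<Lambda>) \<epsilon> \<and> (\<forall>x\<in>closure \<Omega>. 0 < \<epsilon> x) \<and>
          (\<forall>K\<in>\<T>. comparable_on C K \<epsilon> (e K)) \<and> (finite \<T> \<longrightarrow> C_inf_on UNIV \<epsilon>)"
    using exists_length_scale[OF Creg, of \<Omega> C\<epsilon> N M] by blast
  show ?thesis
  proof (rule exI[of _ C], rule exI[of _ L], rule exI[of _ \<Lambda>], intro conjI allI impI)
    show "0 < C" by (rule C)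
  next
    fix \<T> :: "(real^'n) set set" and \<epsilon>t e
    assume *: "is_partition \<Omega> \<T> \<and>
            in_Linf \<Omega> \<epsilon>t \<and> Linf_norm \<Omega> \<epsilon>t = ereal N \<and>
            (\<forall>K\<in>\<T>. 0 < e K \<and> (\<forall>x\<in>K. \<epsilon>t x = e K)) \<and>
            (\<forall>K\<in>\<T>. finite {K'\<in>\<T>. nbhd K (Creg * e K) \<inter> nbhd K' (Creg * e K') \<noteq> {}} \<and>
                    card {K'\<in>\<T>. nbhd K (Creg * e K) \<inter> nbhd K' (Creg * e K') \<noteq> {}} \<le> M) \<and>
            (\<forall>K\<in>\<T>. \<forall>K'\<in>\<T>. nbhd K (Creg * e K) \<inter> nbhd K' (Creg * e K') \<noteq> {} \<longrightarrow>
                    0 < e K \<and> e K \<le> C\<epsilon> * e K')"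
    then have part: "is_partition \<Omega> \<T>" and Linf: "Linf_norm \<Omega> \<epsilon>t = ereal N"
      and e: "\<And>K. K \<in> \<T> \<Longrightarrow> 0 < e K" "\<And>K x. K \<in> \<T> \<Longrightarrow> x \<in> K \<Longrightarrow> \<epsilon>t x = e K"
      by blast+
    have le_N: "e K \<le> N" if K: "K \<in> \<T>" "K \<noteq> {}" for K
    proof (rule open_set_value_le_Linf_norm[OF \<Omega> Linf])
      obtain x where "x \<in> closure K" using K(2) closure_subset by blast
      from partition_element_meets_domain[OF part K(1) this, of 1]
      show "K \<inter> \<Omega> \<noteq> {}" by auto
      show "open (K \<inter> \<Omega>)" using part K(1) \<Omega> by (auto simp: is_partition_def)
    qed (use e(2)[OF K(1)] in auto)
    have "locally_comparable_sizes \<Omega> Creg C\<epsilon> N M \<T> e"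
      unfolding locally_comparable_sizes_def
    proof (intro conjI)
      show "closure \<Omega> = (\<Union>K\<in>\<T>. closure K)" using part by (simp add: is_partition_def)
      show "\<forall>K\<in>\<T>. bounded K \<and> 0 < e K \<and> (K \<noteq> {} \<longrightarrow> e K \<le> N)"
        using part e(1) le_N by (auto simp: is_partition_def)
    qed (use * in blast)+
    from main[OF this] show "\<exists>\<epsilon>. admissible_length_scale \<Omega> (L, \<Lambda>) \<epsilon> \<and> (\<forall>K\<in>\<T>. comparable_on C K \<epsilon> (e K))"
      by blast
  qed
qed

lemma ref_simplex_contains_ball: "\<exists>x0 \<rho>. 0 < \<rho> \<and> ball x0 \<rho> \<subseteq> (ref_simplex :: (real^'n) set)"
proof -
  obtain x0 where "x0 \<in> (ref_simplex :: (real^'n) set)"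
    using interior_std_simplex_nonempty unfolding ref_simplex_def by blast
  moreover have "open (ref_simplex :: (real^'n) set)" by (simp add: ref_simplex_def)
  ultimately show ?thesis by (meson openE)
qed

lemma nbhds_meet_imp_close:
  assumes "nbhd K r \<inter> nbhd K' r' \<noteq> {}"
  shows "\<exists>x\<in>K. \<exists>y\<in>K'. dist x y < r + r'"
proof -
  obtain x y z where "x \<in> K" "y \<in> K'" "dist x z < r" "dist y z < r'"
    using assms by (auto simp: nbhd_def)
  then show ?thesis using dist_triangle_less_add by blast
qed

text \<open>The constants depend on the shape regularity and on \<open>\<Omega>\<close> only. As diameters of elements are at most
  that of \<open>\<Omega>\<close>, a distance below a small multiple of \<open>diameter K\<close> is also below the distance \<open>\<delta>\<close> at
  which short paths exist.\<close>

lemma mesh_size_facts: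
  fixes \<Omega> :: "(real^'n) set"
  assumes \<Omega>: "bounded_lipschitz_domain \<Omega>" and g: "1 \<le> g"
  shows "\<exists>N \<sigma> c. 0 < \<sigma> \<and> 0 < c \<and>
    (\<forall>\<T> A b. simplicial_mesh \<Omega> \<T> A b g \<and> (CARD('n) = 1 \<longrightarrow> comparable_neighbours g \<T>) \<longrightarrow>
      (\<forall>K\<in>\<T>. card {K'\<in>\<T>. closure K' \<inter> closure K \<noteq> {}} \<le> N) \<and>
      (\<forall>K\<in>\<T>. \<forall>K'\<in>\<T>. closure K \<inter> closure K' \<noteq> {} \<longrightarrow> diameter K \<le> \<sigma> * diameter K') \<and>
      (\<forall>K\<in>\<T>. \<forall>x\<in>K. \<forall>y\<in>\<Omega>. dist x y < c * diameter K \<longrightarrow>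
         (\<exists>K'\<in>\<T>. closure K' \<inter> closure K \<noteq> {} \<and> y \<in> closure K')))"
proof -
  have dom: "open \<Omega>" "bounded \<Omega>" "\<Omega> \<noteq> {}" using \<Omega> by (auto simp: bounded_lipschitz_domain_def)
  obtain x0 \<rho> where ref: "0 < \<rho>" "ball x0 \<rho> \<subseteq> (ref_simplex :: (real^'n) set)"
    using ref_simplex_contains_ball by blast
  have "0 < \<rho> / g" using ref g by simp
  from separated_card_bounded[OF this, where 'a = "real^'n"]
  obtain N where N: "\<And>t (v::real^'n) Z. 0 < t \<Longrightarrow> Z \<subseteq> cball v t \<Longrightarrow> separated (\<rho> / g * t) Z \<Longrightarrow> card Z \<le> N"
    by blast
  obtain \<delta> C where path: "0 < \<delta>" "1 \<le> C" "\<And>x y. x \<in> \<Omega> \<Longrightarrow> y \<in> \<Omega> \<Longrightarrow> dist x y < \<delta> \<Longrightarrow> joined_within \<Omega> C x y"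
    using bounded_lipschitz_domain_locally_quasiconvex[OF \<Omega>] by blast
  define \<sigma> where "\<sigma> = max g ((CARD('n) * g) ^ (N * N))"
  have \<sigma>: "0 < \<sigma>" using g by (simp add: \<sigma>_def less_max_iff_disj)
  define c where "c = min (\<delta> / (diameter \<Omega> + 1)) (1 / (3 * C * CARD('n) * g * \<sigma>))"
  have D: "0 \<le> diameter \<Omega>" using dom(2) by (rule diameter_ge_0)
  have c: "0 < c" using path \<sigma> g D by (simp add: c_def)
  have main: "(\<forall>K\<in>\<T>. card {K'\<in>\<T>. closure K' \<inter> closure K \<noteq> {}} \<le> Suc CARD('n) * N) \<and>
      (\<forall>K\<in>\<T>. \<forall>K'\<in>\<T>. closure K \<inter> closure K' \<noteq> {} \<longrightarrow> diameter K \<le> \<sigma> * diameter K') \<and>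
      (\<forall>K\<in>\<T>. \<forall>x\<in>K. \<forall>y\<in>\<Omega>. dist x y < c * diameter K \<longrightarrow>
         (\<exists>K'\<in>\<T>. closure K' \<inter> closure K \<noteq> {} \<and> y \<in> closure K'))"
    if mesh: "simplicial_mesh \<Omega> \<T> A b g" and dim1: "CARD('n) = 1 \<longrightarrow> comparable_neighbours g \<T>" for \<T> A b
  proof -
    interpret simplicial_mesh \<Omega> \<T> A b g by (rule mesh)
    have card: "card {K\<in>\<T>. v \<in> closure K} \<le> N" for v
      by (rule card_elements_at_point[OF ref(2,1) N])
    have size: "diameter K \<le> \<sigma> * diameter K'"
      if K: "K \<in> \<T>" "K' \<in> \<T>" and meet: "closure K \<inter> closure K' \<noteq> {}" for K K'
    proof -
      obtain v where v: "v \<in> closure K" "v \<in> closure K'" using meet by blast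
      have "diameter K \<le> max g ((CARD('n) * g) ^ (N * N)) * diameter K'"
      proof (cases "CARD('n) = 1")
        case True
        then have "diameter K \<le> g * diameter K'"
          using dim1 K meet by (simp add: comparable_neighbours_def)
        also have "\<dots> \<le> max g ((CARD('n) * g) ^ (N * N)) * diameter K'"
          using diameter_pos[OF K(2)] by (intro mult_right_mono) auto
        finally show ?thesis .
      next
        case False
        moreover have "0 < CARD('n)" by simp
        ultimately have "2 \<le> CARD('n)" by linarith
        from diameter_comparable_at_point[OF dom(1) this path card K(1) v(1) K(2) v(2)]
        have "diameter K \<le> (CARD('n) * g) ^ (N * N) * diameter K'" .
        also have "\<dots> \<le> max g ((CARD('n) * g) ^ (N * N)) * diameter K'"
          using diameter_pos[OF K(2)] by (intro mult_right_mono) auto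
        finally show ?thesis .
      qed
      then show ?thesis by (simp only: \<sigma>_def)
    qed
    have patch: "\<exists>K'\<in>\<T>. closure K' \<inter> closure K \<noteq> {} \<and> y \<in> closure K'"
      if K: "K \<in> \<T>" "x \<in> K" and y: "y \<in> \<Omega>" and xy: "dist x y < c * diameter K" for K x y
    proof (rule close_points_in_patch[OF path \<sigma> size K y])
      have h: "0 < diameter K" using diameter_pos[OF K(1)] .
      have "K \<subseteq> closure \<Omega>" using closure_domain K(1) closure_subset[of K] by blast
      then have "diameter K \<le> diameter \<Omega>"
        using diameter_subset[of K "closure \<Omega>"] dom(2) by (simp add: diameter_closure bounded_closure)
      then have "c * diameter K \<le> \<delta> / (diameter \<Omega> + 1) * (diameter \<Omega> + 1)"
        using h path(1) D by (intro mult_mono) (auto simp: c_def)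
      then show "dist x y < \<delta>" using xy D by simp
      have "c * diameter K \<le> 1 / (3 * C * CARD('n) * g * \<sigma>) * diameter K"
        using h by (intro mult_right_mono) (auto simp: c_def)
      then show "dist x y < diameter K / (3 * C * CARD('n) * g * \<sigma>)" using xy by simp
    qed
    show ?thesis
      using card_neighbours[OF card] size patch by blast
  qed
  show ?thesis
    by (rule exI[of _ "Suc CARD('n) * N"], rule exI[of _ \<sigma>], rule exI[of _ c],
        intro conjI[OF \<sigma> conjI[OF c]] allI impI, elim conjE, rule main)
qed

text \<open>The sizes are \<open>\<kappa> * diameter K / (p K + 1)\<close>. The bound \<open>2 * \<kappa> \<le> c\<close> ensures that
  overlapping neighbourhoods belong to touching elements, and \<open>C * \<kappa> \<le> c\<close> that the length scale on \<open>K\<close>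
  stays below the width of the patch. Both can be achieved because \<open>C\<close> is known before \<open>\<kappa>\<close> is chosen: multiplying all sizes by
  \<open>\<kappa>\<close> does not change their ratios.\<close>

lemma mesh_length_scale:
  fixes \<Omega> :: "(real^'n) set"
  assumes \<Omega>: "bounded_lipschitz_domain \<Omega>"
  shows "\<exists>(C::real) L (\<Lambda> :: ('n \<Rightarrow> nat) \<Rightarrow> real). 0 < C \<and>
         (\<forall>(\<T> :: (real^'n) set set) A b (p :: (real^'n) set \<Rightarrow> nat).
            is_mesh \<Omega> \<T> A b \<and> shape_regular_mesh \<gamma> \<T> A \<and> shape_regular_degrees \<gamma>p \<T> p \<and>
            (CARD('n) = 1 \<longrightarrow> comparable_neighbours \<gamma> \<T>)
            \<longrightarrow> (\<exists>\<epsilon>. admissible_length_scale \<Omega> (L, \<Lambda>) \<epsilon> \<and>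
                     C_inf_closure \<Omega> \<epsilon> \<and> (\<forall>x\<in>closure \<Omega>. 0 < \<epsilon> x) \<and>
                     (\<forall>K\<in>\<T>. comparable_on C K \<epsilon> (diameter K / (real (p K) + 1)) \<and>
                            \<Omega> \<inter> (\<Union>x\<in>K. ball x (\<epsilon> x)) \<subseteq> element_patch \<T> K)))"
proof -
  define g where "g = max \<gamma> 1"
  have g: "1 \<le> g" "\<gamma> \<le> g" by (auto simp: g_def)
  obtain N \<sigma> c where \<sigma>: "0 < \<sigma>" and c: "0 < c" and
    facts: "\<forall>\<T> A b. simplicial_mesh \<Omega> \<T> A b g \<and> (CARD('n) = 1 \<longrightarrow> comparable_neighbours g \<T>) \<longrightarrow>
      (\<forall>K\<in>\<T>. card {K'\<in>\<T>. closure K' \<inter> closure K \<noteq> {}} \<le> N) \<and>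
      (\<forall>K\<in>\<T>. \<forall>K'\<in>\<T>. closure K \<inter> closure K' \<noteq> {} \<longrightarrow> diameter K \<le> \<sigma> * diameter K') \<and>
      (\<forall>K\<in>\<T>. \<forall>x\<in>K. \<forall>y\<in>\<Omega>. dist x y < c * diameter K \<longrightarrow>
         (\<exists>K'\<in>\<T>. closure K' \<inter> closure K \<noteq> {} \<and> y \<in> closure K'))"
    using mesh_size_facts[OF \<Omega> g(1)] by (elim exE conjE) (rule that; assumption)
  obtain C L \<Lambda> where C: "0 < C" and
    core: "\<And>\<T> e. locally_comparable_sizes \<Omega> 1 (\<sigma> * \<gamma>p) (diameter \<Omega>) N \<T> e \<Longrightarrow>
     \<exists>\<epsilon>. admissible_length_scale \<Omega> (L, \<Lambda>) \<epsilon> \<and> (\<forall>x\<in>closure \<Omega>. 0 < \<epsilon> x) \<and>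
          (\<forall>K\<in>\<T>. comparable_on C K \<epsilon> (e K)) \<and> (finite \<T> \<longrightarrow> C_inf_on UNIV \<epsilon>)"
    using exists_length_scale[of 1 \<Omega> "\<sigma> * \<gamma>p" "diameter \<Omega>" N] by auto
  define \<kappa> where "\<kappa> = min 1 (min (c / 2) (c / C))"
  have \<kappa>: "0 < \<kappa>" "\<kappa> \<le> 1" "2 * \<kappa> \<le> c" "C * \<kappa> \<le> c"
    using c C by (auto simp: \<kappa>_def min_def field_simps)
  have bounded: "bounded \<Omega>" using \<Omega> by (simp add: bounded_lipschitz_domain_def)
  have open_\<Omega>: "open \<Omega>" using \<Omega> by (simp add: bounded_lipschitz_domain_def)
  have main: "\<exists>\<epsilon>. admissible_length_scale \<Omega> (L, \<Lambda>) \<epsilon> \<and>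
             C_inf_closure \<Omega> \<epsilon> \<and> (\<forall>x\<in>closure \<Omega>. 0 < \<epsilon> x) \<and>
             (\<forall>K\<in>\<T>. comparable_on (C / \<kappa>) K \<epsilon> (diameter K / (real (p K) + 1)) \<and>
                    \<Omega> \<inter> (\<Union>x\<in>K. ball x (\<epsilon> x)) \<subseteq> element_patch \<T> K)"
    if is_mesh: "is_mesh \<Omega> \<T> A b" and shape: "shape_regular_mesh \<gamma> \<T> A"
      and degrees: "shape_regular_degrees \<gamma>p \<T> p"
      and dim1: "CARD('n) = 1 \<longrightarrow> comparable_neighbours \<gamma> \<T>"
    for \<T> A b p
  proof -
    have "shape_regular_mesh g \<T> A"
      using shape g(2) unfolding shape_regular_mesh_def by force
    then have sm: "simplicial_mesh \<Omega> \<T> A b g"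
      using is_mesh g(1) by unfold_locales
    interpret simplicial_mesh \<Omega> \<T> A b g by (rule sm)
    have "comparable_neighbours g \<T>" if "CARD('n) = 1"
      unfolding comparable_neighbours_def
    proof (intro ballI impI)
      fix K K' assume K: "K \<in> \<T>" "K' \<in> \<T>" "closure K \<inter> closure K' \<noteq> {}"
      then have "diameter K \<le> \<gamma> * diameter K'" using dim1 that by (simp add: comparable_neighbours_def)
      also have "\<dots> \<le> g * diameter K'" using g(2) diameter_pos[OF K(2)] by (intro mult_right_mono) auto
      finally show "diameter K \<le> g * diameter K'" .
    qed
    note f = facts[THEN spec, THEN spec, THEN spec, THEN mp, OF conjI[OF sm impI[OF this]]]
    have card: "card {K'\<in>\<T>. closure K' \<inter> closure K \<noteq> {}} \<le> N" if "K \<in> \<T>" for K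
      using f that by blast
    have size: "diameter K \<le> \<sigma> * diameter K'" if "K \<in> \<T>" "K' \<in> \<T>" "closure K \<inter> closure K' \<noteq> {}" for K K'
      using f that by blast
    have patch: "\<exists>K'\<in>\<T>. closure K' \<inter> closure K \<noteq> {} \<and> y \<in> closure K'"
      if "K \<in> \<T>" "x \<in> K" "y \<in> \<Omega>" "dist x y < c * diameter K" for K x y
      using f that by blast
    define e where "e K = \<kappa> * (diameter K / (real (p K) + 1))" for K
    have e_le: "e K \<le> \<kappa> * diameter K" if "K \<in> \<T>" for K
      unfolding e_def using \<kappa>(1) diameter_pos[OF that]
      by (intro mult_left_mono) (auto simp: divide_le_eq mult_left_mono[of 1])
    have e_pos: "0 < e K" if "K \<in> \<T>" for K
      unfolding e_def using \<kappa>(1) diameter_pos[OF that] by (intro mult_pos_pos divide_pos_pos) auto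
    have le_diam: "diameter K \<le> diameter \<Omega>" if K: "K \<in> \<T>" for K
    proof -
      have "K \<subseteq> closure \<Omega>" using closure_domain K closure_subset[of K] by blast
      then show ?thesis
        using diameter_subset[of K "closure \<Omega>"] bounded by (simp add: diameter_closure bounded_closure)
    qed
    \<comment> \<open>It suffices to compare with the larger element, whose patch is wide enough to contain points of the smaller one.\<close>
    have meet_le: "closure K \<inter> closure K' \<noteq> {}"
      if K: "K \<in> \<T>" "K' \<in> \<T>" and meet: "nbhd K (1 * e K) \<inter> nbhd K' (1 * e K') \<noteq> {}" and le: "diameter K' \<le> diameter K"
      for K K'
    proof -
      obtain x y where xy: "x \<in> K" "y \<in> K'" "dist x y < e K + e K'"
        using nbhds_meet_imp_close[OF meet] by auto
      define s where "s = e K + e K' - dist x y"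
      have "0 < s" using xy by (simp add: s_def)
      moreover have "y \<in> closure K'" using xy closure_subset by blast
      ultimately obtain y' where y': "y' \<in> K'" "y' \<in> \<Omega>" "dist y y' < s"
        using partition_element_meets_domain[OF partition K(2), of y s] by auto
      have "\<kappa> * diameter K' \<le> \<kappa> * diameter K" using le \<kappa>(1) by simp
      moreover have "2 * \<kappa> * diameter K \<le> c * diameter K"
        using \<kappa>(3) diameter_pos[OF K(1)] by (intro mult_right_mono) auto
      ultimately have "dist x y' < c * diameter K"
        using y'(3) dist_triangle[of x y' y] e_le[OF K(1)] e_le[OF K(2)] by (simp add: s_def)
      then obtain K'' where K'': "K'' \<in> \<T>" "closure K'' \<inter> closure K \<noteq> {}" "y' \<in> closure K''"
        using patch[OF K(1) xy(1) y'(2)] by blast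
      have "K' \<inter> K'' \<noteq> {}"
        using open_Int_closure_eq_empty[OF open_element[OF K(2)], of K''] y'(1) K''(3) by blast
      then have "K'' = K'" using elements_disjoint[OF K(2) K''(1)] by blast
      then show ?thesis using K''(2) by blast
    qed
    have meet: "closure K \<inter> closure K' \<noteq> {}"
      if K: "K \<in> \<T>" "K' \<in> \<T>" and meet: "nbhd K (1 * e K) \<inter> nbhd K' (1 * e K') \<noteq> {}" for K K'
      using meet_le[OF K meet] meet_le[OF K(2,1)] meet by (metis Int_commute linear)
    have "locally_comparable_sizes \<Omega> 1 (\<sigma> * \<gamma>p) (diameter \<Omega>) N \<T> e"
      unfolding locally_comparable_sizes_def
    proof (intro conjI ballI impI)
      show "closure \<Omega> = (\<Union>K\<in>\<T>. closure K)" by (rule closure_domain)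
      fix K assume K: "K \<in> \<T>"
      show "bounded K" "0 < e K" using bounded_element e_pos K by auto
      have "\<kappa> * diameter K \<le> 1 * diameter K" using \<kappa>(2) diameter_pos[OF K] by (intro mult_right_mono) auto
      then show "e K \<le> diameter \<Omega>" using e_le[OF K] le_diam[OF K] by simp
      show "finite {K'\<in>\<T>. nbhd K (1 * e K) \<inter> nbhd K' (1 * e K') \<noteq> {}}" using finite_mesh by simp
      have "card {K'\<in>\<T>. nbhd K (1 * e K) \<inter> nbhd K' (1 * e K') \<noteq> {}} \<le> card {K'\<in>\<T>. closure K' \<inter> closure K \<noteq> {}}"
      proof (rule card_mono)
        show "finite {K'\<in>\<T>. closure K' \<inter> closure K \<noteq> {}}" using finite_mesh by simp
        show "{K'\<in>\<T>. nbhd K (1 * e K) \<inter> nbhd K' (1 * e K') \<noteq> {}} \<subseteq> {K'\<in>\<T>. closure K' \<inter> closure K \<noteq> {}}"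
          using meet[OF K] by (simp add: subset_iff Int_commute)
      qed
      then show "card {K'\<in>\<T>. nbhd K (1 * e K) \<inter> nbhd K' (1 * e K') \<noteq> {}} \<le> N"
        using card[OF K] by simp
      fix K' assume K': "K' \<in> \<T>" and "nbhd K (1 * e K) \<inter> nbhd K' (1 * e K') \<noteq> {}"
      then have touch: "closure K \<inter> closure K' \<noteq> {}" by (rule meet[OF K])
      have "real (p K') + 1 \<le> \<gamma>p * (real (p K) + 1)"
        using degrees K K' touch unfolding shape_regular_degrees_def by blast
      then have deg: "1 / (real (p K) + 1) \<le> \<gamma>p / (real (p K') + 1)"
        by (simp add: divide_le_eq le_divide_eq add_pos_pos field_simps add_nonneg_pos)
      have "diameter K * (1 / (real (p K) + 1)) \<le> (\<sigma> * diameter K') * (\<gamma>p / (real (p K') + 1))"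
        using size[OF K K' touch] deg \<sigma> diameter_pos[OF K'] by (intro mult_mono) auto
      then have "\<kappa> * (diameter K * (1 / (real (p K) + 1))) \<le> \<kappa> * ((\<sigma> * diameter K') * (\<gamma>p / (real (p K') + 1)))"
        using \<kappa>(1) by (intro mult_left_mono) auto
      then show "e K \<le> \<sigma> * \<gamma>p * e K'" by (simp add: e_def mult_ac)
    qed
    from core[OF this] obtain \<epsilon> where \<epsilon>: "admissible_length_scale \<Omega> (L, \<Lambda>) \<epsilon>" "\<And>x. x \<in> closure \<Omega> \<Longrightarrow> 0 < \<epsilon> x"
      "\<And>K. K \<in> \<T> \<Longrightarrow> comparable_on C K \<epsilon> (e K)" "C_inf_on UNIV \<epsilon>"
      using finite_mesh by blast
    have cmp: "comparable_on (C / \<kappa>) K \<epsilon> (diameter K / (real (p K) + 1))" if K: "K \<in> \<T>" for K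
      unfolding comparable_on_def
    proof (intro ballI conjI)
      fix x assume x: "x \<in> K"
      have "inverse C * e K \<le> \<epsilon> x" and up: "\<epsilon> x \<le> C * e K"
        using \<epsilon>(3)[OF K] x by (auto simp: comparable_on_def)
      then show "inverse (C / \<kappa>) * (diameter K / (real (p K) + 1)) \<le> \<epsilon> x"
        by (simp add: e_def divide_inverse mult_ac)
      have "C * \<kappa> \<le> C / \<kappa>"
      proof -
        have "\<kappa> * \<kappa> \<le> 1 * 1" using \<kappa>(1,2) by (intro mult_mono) auto
        then have "C * (\<kappa> * \<kappa>) \<le> C * 1" using C by (intro mult_left_mono) auto
        then show ?thesis using \<kappa>(1) by (simp add: le_divide_eq mult.assoc)
      qed
      then have "C * \<kappa> * (diameter K / (real (p K) + 1)) \<le> C / \<kappa> * (diameter K / (real (p K) + 1))"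
        using diameter_pos[OF K] by (intro mult_right_mono) auto
      with up show "\<epsilon> x \<le> C / \<kappa> * (diameter K / (real (p K) + 1))"
        by (simp add: e_def mult.assoc)
    qed
    have balls: "\<Omega> \<inter> (\<Union>x\<in>K. ball x (\<epsilon> x)) \<subseteq> element_patch \<T> K" if K: "K \<in> \<T>" for K
      unfolding element_patch_def
    proof (rule interior_maximal)
      show "open (\<Omega> \<inter> (\<Union>x\<in>K. ball x (\<epsilon> x)))" using open_\<Omega> by (intro open_Int open_UN) auto
      show "\<Omega> \<inter> (\<Union>x\<in>K. ball x (\<epsilon> x)) \<subseteq> \<Union>{closure K' |K'. K' \<in> \<T> \<and> closure K' \<inter> closure K \<noteq> {}}"
      proof
        fix y assume "y \<in> \<Omega> \<inter> (\<Union>x\<in>K. ball x (\<epsilon> x))"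
        then obtain x where x: "x \<in> K" "y \<in> \<Omega>" "dist x y < \<epsilon> x" by auto
        have "\<epsilon> x \<le> C * e K" using \<epsilon>(3)[OF K] x(1) by (auto simp: comparable_on_def)
        also have "\<dots> \<le> C * (\<kappa> * diameter K)" using C e_le[OF K] by (intro mult_left_mono) auto
        also have "\<dots> \<le> c * diameter K"
          unfolding mult.assoc[symmetric] using \<kappa>(4) diameter_pos[OF K] by (intro mult_right_mono) auto
        finally have "dist x y < c * diameter K" using x(3) by simp
        from patch[OF K x(1,2) this]
        show "y \<in> \<Union>{closure K' |K'. K' \<in> \<T> \<and> closure K' \<inter> closure K \<noteq> {}}" by blast
      qed
    qed
    have "C_inf_closure \<Omega> \<epsilon>" unfolding C_inf_closure_def using \<epsilon>(4) by blast
    with \<epsilon>(1,2) cmp balls show ?thesis by (intro exI[of _ \<epsilon>] conjI ballI) auto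
  qed
  have pos: "0 < C / \<kappa>" using C \<kappa>(1) by simp
  show ?thesis
    by (rule exI[of _ "C / \<kappa>"], rule exI[of _ L], rule exI[of _ \<Lambda>],
        intro conjI[OF pos] allI impI, elim conjE, rule main)
qed

theorem lemma3p1:
  fixes \<Omega> :: "(real^'n) set"
  assumes "bounded_lipschitz_domain \<Omega>"
  shows
    "(\<forall>(C\<epsilon>::real) (Creg::real) (N::real) (M::nat). 0 < C\<epsilon> \<and> 0 < Creg \<longrightarrow>
       (\<exists>(C::real) L (\<Lambda> :: ('n \<Rightarrow> nat) \<Rightarrow> real). 0 < C \<and>
         (\<forall>(\<T> :: (real^'n) set set) (\<epsilon>t :: real^'n \<Rightarrow> real) (e :: (real^'n) set \<Rightarrow> real).
            is_partition \<Omega> \<T> \<and>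
            in_Linf \<Omega> \<epsilon>t \<and> Linf_norm \<Omega> \<epsilon>t = ereal N \<and>
            (\<forall>K\<in>\<T>. 0 < e K \<and> (\<forall>x\<in>K. \<epsilon>t x = e K)) \<and>
            (\<forall>K\<in>\<T>. finite {K'\<in>\<T>. nbhd K (Creg * e K) \<inter> nbhd K' (Creg * e K') \<noteq> {}} \<and>
                    card {K'\<in>\<T>. nbhd K (Creg * e K) \<inter> nbhd K' (Creg * e K') \<noteq> {}} \<le> M) \<and>
            (\<forall>K\<in>\<T>. \<forall>K'\<in>\<T>. nbhd K (Creg * e K) \<inter> nbhd K' (Creg * e K') \<noteq> {} \<longrightarrow>
                    0 < e K \<and> e K \<le> C\<epsilon> * e K')
            \<longrightarrow> (\<exists>\<epsilon>. admissible_length_scale \<Omega> (L, \<Lambda>) \<epsilon> \<and>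
                     (\<forall>K\<in>\<T>. comparable_on C K \<epsilon> (e K))))))
     \<and>
     (\<forall>(\<gamma>::real) (\<gamma>p::real).
       (\<exists>(C::real) L (\<Lambda> :: ('n \<Rightarrow> nat) \<Rightarrow> real). 0 < C \<and>
         (\<forall>(\<T> :: (real^'n) set set) A b (p :: (real^'n) set \<Rightarrow> nat).
            is_mesh \<Omega> \<T> A b \<and> shape_regular_mesh \<gamma> \<T> A \<and> shape_regular_degrees \<gamma>p \<T> p \<and>
            (CARD('n) = 1 \<longrightarrow> comparable_neighbours \<gamma> \<T>)
            \<longrightarrow> (\<exists>\<epsilon>. admissible_length_scale \<Omega> (L, \<Lambda>) \<epsilon> \<and>
                     C_inf_closure \<Omega> \<epsilon> \<and> (\<forall>x\<in>closure \<Omega>. 0 < \<epsilon> x) \<and>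
                     (\<forall>K\<in>\<T>. comparable_on C K \<epsilon> (diameter K / (real (p K) + 1)) \<and>
                            \<Omega> \<inter> (\<Union>x\<in>K. ball x (\<epsilon> x)) \<subseteq> element_patch \<T> K)))))"
proof (intro conjI allI impI, elim conjE)
  have "open \<Omega>" using assms by (simp add: bounded_lipschitz_domain_def)
  then show "\<exists>(C::real) L (\<Lambda> :: ('n \<Rightarrow> nat) \<Rightarrow> real). 0 < C \<and>
         (\<forall>(\<T> :: (real^'n) set set) (\<epsilon>t :: real^'n \<Rightarrow> real) (e :: (real^'n) set \<Rightarrow> real).
            is_partition \<Omega> \<T> \<and>
            in_Linf \<Omega> \<epsilon>t \<and> Linf_norm \<Omega> \<epsilon>t = ereal N \<and>
            (\<forall>K\<in>\<T>. 0 < e K \<and> (\<forall>x\<in>K. \<epsilon>t x = e K)) \<and>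
            (\<forall>K\<in>\<T>. finite {K'\<in>\<T>. nbhd K (Creg * e K) \<inter> nbhd K' (Creg * e K') \<noteq> {}} \<and>
                    card {K'\<in>\<T>. nbhd K (Creg * e K) \<inter> nbhd K' (Creg * e K') \<noteq> {}} \<le> M) \<and>
            (\<forall>K\<in>\<T>. \<forall>K'\<in>\<T>. nbhd K (Creg * e K) \<inter> nbhd K' (Creg * e K') \<noteq> {} \<longrightarrow>
                    0 < e K \<and> e K \<le> C\<epsilon> * e K')
            \<longrightarrow> (\<exists>\<epsilon>. admissible_length_scale \<Omega> (L, \<Lambda>) \<epsilon> \<and>
                     (\<forall>K\<in>\<T>. comparable_on C K \<epsilon> (e K))))"
    if "0 < Creg" for C\<epsilon> Creg N :: real and M :: nat
    using that by (rule piecewise_constant_length_scale)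
qed (rule mesh_length_scale[OF assms])

end
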